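(* Let $\mathcal A$, $\varepsilon$, $a$, $Q$, $\sigma^I$, $\overline\sigma_\pm^I$, $\overline\sigma_I$, $G_\pm$ be as in the context. Then the generators $\Lambda_L{}^K$ $(L,K=0,1,2,3)$ of the quantum Lorentz group are given by $$\Lambda_L{}^K=\frac1Q\,\varepsilon_{\dot\gamma\dot\delta}\,\overline\sigma_L^{\dot\delta\alpha}\,M_\alpha{}^\sigma\,\sigma^K_{\sigma\dot\rho}\,M_{\dot\beta}{}^{\dot\rho}\,\varepsilon^{\dot\gamma\dot\beta}=\frac1Q\,\overline\sigma_{L\dot\gamma}{}^{\alpha}\,M_\alpha{}^\sigma\,\sigma^{K}{}_{\sigma}{}^{\dot\rho}\,S^{-1}(M_{\dot\rho}{}^{\dot\gamma}),$$ or, for either choice of sign, equivalently by $$\Lambda_L{}^K=\frac1Q\,\varepsilon^{\alpha\delta}M_\alpha{}^\sigma\,\sigma^K_{\sigma\dot\rho}\,M_{\dot\beta}{}^{\dot\rho}\,\overline\sigma_\pm^{N\dot\beta\gamma}\,\varepsilon_{\gamma\delta}\,G_{\pm NL}$$ (all these expressions coincide). The $\Lambda_L{}^K$ are real, $(\Lambda_L{}^K)^\star=\Lambda_L{}^K$; they satisfy the axiomatic structure of Hopf algebras, i.e. the unital subalgebra $\mathcal L\subset\mathcal A$ generated by them is a Hopf algebra with the coproduct, counit and antipode of $\mathcal A$ restricted to $\mathcal L$; and, for both signs, they satisfy $$G_{\pm NM}\Lambda_L{}^N\Lambda_K{}^M=G_{\pm LK}I_{\mathcal L},\qquad G_\pm^{LK}\Lambda_L{}^N\Lambda_K{}^M=G_\pm^{NM}I_{\mathcal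 L},$$ where $I_{\mathcal L}=I_{\mathcal A}$ is the unit of $\mathcal L\subset\mathcal A$.
   Context: Conventions. Spinor indices $\alpha,\beta,\dots$ and dotted indices $\dot\alpha,\dot\beta,\dots$ run over $\{1,2\}$; $I,J,K,L,\dots$ run over $\{0,1,2,3\}$. Repeated indices are summed; an undotted index $\alpha$ and the dotted index $\dot\alpha$ with the same letter have the same numerical value. On complex numbers $\star$ is complex conjugation. In formulas with $\pm,\mp$ the upper signs go together and the lower signs go together. Spinor metric. $(\varepsilon_{\alpha\beta})$ is an invertible complex $2\times2$ matrix with inverse $(\varepsilon^{\alpha\beta})$: $\varepsilon^{\alpha\gamma}\varepsilon_{\gamma\beta}=\delta^\alpha_\beta=\varepsilon_{\beta\gamma}\varepsilon^{\gamma\alpha}$. Dotted versions: $\varepsilon_{\dot\beta\dot\alpha}:=(\varepsilon_{\alpha\beta})^\star$, $\varepsilon^{\dot\beta\dot\alpha}:=(\varepsilon^{\alpha\beta})^\star$. It is assumed that $\varepsilon_{\dot\beta\dot\alpha}=-\varepsilon^{\alpha\beta}$ and $\varepsilon^{\dot\beta\dot\alpha}=-\varepsilon_{\alpha\beta}$. $R$ matrices. $a\neq0$ is a real number with $a+a^{-1}+\varepsilon^{\alpha\beta}\varepsilon_{\alpha\beta}=0$ (then $a>0$, and $a^{1/2}$ is the positive root), $Q:=a+a^{-1}$, and $R^{\pm\alpha\beta}_{\ \ \gamma\delta}=\delta^\alpha_\gamma\delta^\beta_\delta+a^{\pm1}\varepsilon^{\alpha\beta}\varepsilon_{\gamma\delta}$.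 Mixed $R$ matrices are defined by $R^{\pm\dot\delta\gamma}_{\ \ \alpha\dot\sigma}:=a^{\pm1/2}R^{\mp\gamma\sigma}_{\ \ \delta\alpha}$ and $R^{\mp\gamma\dot\delta}_{\ \ \dot\sigma\alpha}:=a^{\pm1/2}\varepsilon_{\delta\lambda}R^{\mp\gamma\lambda}_{\ \ \nu\alpha}\varepsilon^{\nu\sigma}$. The $\star$-Hopf algebra $\mathcal A$ (quantum $SL(2,\mathbb C)$). $\mathcal A$ is a complex unital $\star$-algebra with unit $I_{\mathcal A}$ ($\star$ antilinear and antimultiplicative) generated by $M_\alpha{}^\beta$ and $M_{\dot\alpha}{}^{\dot\beta}:=(M_\alpha{}^\beta)^\star$, satisfying $\varepsilon_{\alpha\beta}M_\gamma{}^\alpha M_\delta{}^\beta=\varepsilon_{\gamma\delta}I_{\mathcal A}$, $\varepsilon^{\gamma\delta}M_\gamma{}^\alpha M_\delta{}^\beta=\varepsilon^{\alpha\beta}I_{\mathcal A}$, the same relations with all indices dotted, and, for both signs, $M_\alpha{}^\gamma M_{\dot\sigma}{}^{\dot\delta}R^{\pm\dot\rho\beta}_{\ \ \gamma\dot\delta}=R^{\pm\dot\delta\gamma}_{\ \ \alpha\dot\sigma}M_{\dot\delta}{}^{\dot\rho}M_\gamma{}^\beta$. It is a $\star$-Hopf algebra with $\Delta(M_\alpha{}^\beta)=M_\alpha{}^\gamma\otimes M_\gamma{}^\beta$, counit $\varepsilon(M_\alpha{}^\beta)=\delta_\alpha^\beta$, antipode $S(M_\alpha{}^\beta)=\varepsilon_{\alpha\gamma}M_\delta{}^\gamma\varepsilon^{\delta\beta}$,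 and the same formulas with dotted indices; $S^{-1}(M_{\dot\alpha}{}^{\dot\beta})=\varepsilon^{\dot\beta\dot\delta}M_{\dot\delta}{}^{\dot\gamma}\varepsilon_{\dot\gamma\dot\alpha}$. Quantum Pauli matrices and metric. $\sigma^I=(\sigma^I_{\alpha\dot\beta})$, $I=0,\dots,3$, are four linearly independent hermitean complex $2\times2$ matrices ($(\sigma^I_{\alpha\dot\beta})^\star=\sigma^I_{\beta\dot\alpha}$), and $\overline\sigma_\pm^{I\dot\alpha\beta}:=\varepsilon^{\dot\alpha\dot\lambda}R^{\mp\sigma\dot\rho}_{\ \ \dot\lambda\nu}\varepsilon^{\nu\beta}\sigma^I_{\sigma\dot\rho}$. The metric is $G_\pm^{IJ}:=\frac1Q\varepsilon^{\alpha\nu}\sigma^I_{\alpha\dot\beta}\overline\sigma_\pm^{J\dot\beta\gamma}\varepsilon_{\gamma\nu}=\frac1Q\varepsilon_{\dot\nu\dot\gamma}\overline\sigma_\pm^{I\dot\gamma\alpha}\sigma^J_{\alpha\dot\beta}\varepsilon^{\dot\nu\dot\beta}$, and $(G_{\pm IJ})$ is the inverse matrix of $(G_\pm^{IJ})$. One sets $\overline\sigma_I^{\dot\alpha\beta}:=G_{\pm IJ}\overline\sigma_\pm^{J\dot\alpha\beta}$ (both signs give the same matrices), $\overline\sigma_{L\dot\gamma}{}^{\alpha}:=\varepsilon_{\dot\gamma\dot\delta}\overline\sigma_L^{\dot\delta\alpha}$ and $\sigma^K{}_\sigma{}^{\dot\rho}:=\varepsilon^{\dot\rho\dot\beta}\sigma^K_{\sigma\dot\beta}$.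 *)

theory Defs
  imports "HOL-Analysis.Analysis" "HOL-Library.Multiset"
begin

section \<open>Complex vector spaces, algebras and star-algebras\<close>

class complex_vector = ab_group_add +
  fixes scaleC :: "complex \<Rightarrow> 'a \<Rightarrow> 'a"  (infixr "*\<^sub>C" 75)
  assumes scaleC_add_right: "c *\<^sub>C (x + y) = c *\<^sub>C x + c *\<^sub>C y"
    and scaleC_add_left: "(c + d) *\<^sub>C x = c *\<^sub>C x + d *\<^sub>C x"
    and scaleC_scaleC: "c *\<^sub>C d *\<^sub>C x = (c * d) *\<^sub>C x"
    and scaleC_one: "1 *\<^sub>C x = x"

global_interpretation complex_vector: vector_space "scaleC :: complex \<Rightarrow> 'a \<Rightarrow> 'a::complex_vector"
  by unfold_locales (simp_all add: scaleC_add_right scaleC_add_left scaleC_scaleC scaleC_one)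

class complex_algebra_1 = complex_vector + ring_1 +
  assumes mult_scaleC_left: "(c *\<^sub>C x) * y = c *\<^sub>C (x * y)"
    and mult_scaleC_right: "x * (c *\<^sub>C y) = c *\<^sub>C (x * y)"

class complex_star_algebra_1 = complex_algebra_1 +
  fixes star :: "'a \<Rightarrow> 'a"
  assumes star_star: "star (star x) = x"
    and star_add: "star (x + y) = star x + star y"
    and star_scaleC: "star (c *\<^sub>C x) = cnj c *\<^sub>C star x"
    and star_mult: "star (x * y) = star y * star x"

definition unital_subalgebra :: "'a::complex_algebra_1 set \<Rightarrow> bool" where
  "unital_subalgebra B \<longleftrightarrow> 1 \<in> B \<and> (\<forall>x\<in>B. \<forall>y\<in>B. x + y \<in> B \<and> x * y \<in> B)
     \<and> (\<forall>c. \<forall>x\<in>B. c *\<^sub>C x \<in> B)"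


section \<open>Tensor products over the complex numbers\<close>

text \<open>A multiset of pairs stands for the formal sum of the corresponding elementary tensors;
  the tensor product is the quotient by the smallest congruence that makes elementary tensors
  additive in each factor and balanced over the scalars.\<close>

inductive tensor_eq :: "('a::complex_vector \<times> 'b::complex_vector) multiset \<Rightarrow> ('a \<times> 'b) multiset \<Rightarrow> bool"
  where
    refl: "tensor_eq X X"
  | sym: "tensor_eq X Y \<Longrightarrow> tensor_eq Y X"
  | trans: "tensor_eq X Y \<Longrightarrow> tensor_eq Y Z \<Longrightarrow> tensor_eq X Z"
  | cong: "tensor_eq X Y \<Longrightarrow> tensor_eq X' Y' \<Longrightarrow> tensor_eq (X + X') (Y + Y')"
  | zero: "tensor_eq {#(0, b)#} {#}"
  | add_left: "tensor_eq {#(a + a', b)#} {#(a, b), (a', b)#}"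
  | add_right: "tensor_eq {#(a, b + b')#} {#(a, b), (a, b')#}"
  | scale: "tensor_eq {#(c *\<^sub>C a, b)#} {#(a, c *\<^sub>C b)#}"

quotient_type (overloaded) ('a, 'b) tensor =
  "('a::complex_vector \<times> 'b::complex_vector) multiset" / tensor_eq
  by (rule equivpI) (auto simp: reflp_def symp_def transp_def intro: tensor_eq.intros)

lemma tensor_eq_scale_left:
  "tensor_eq X Y \<Longrightarrow>
    tensor_eq (image_mset (\<lambda>(a, b). (c *\<^sub>C a, b)) X) (image_mset (\<lambda>(a, b). (c *\<^sub>C a, b)) Y)"
proof (induction rule: tensor_eq.induct)
  case (scale d a b)
  show ?case
    using tensor_eq.scale[of d "c *\<^sub>C a" b] by (simp add: mult.commute)
qed (auto simp: scaleC_add_right intro: tensor_eq.intros)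

instantiation tensor :: (complex_vector, complex_vector) complex_vector
begin

lift_definition zero_tensor :: "('a, 'b) tensor" is "{#}" .

lift_definition plus_tensor :: "('a, 'b) tensor \<Rightarrow> ('a, 'b) tensor \<Rightarrow> ('a, 'b) tensor" is "(+)"
  by (rule tensor_eq.cong)

lift_definition scaleC_tensor :: "complex \<Rightarrow> ('a, 'b) tensor \<Rightarrow> ('a, 'b) tensor"
  is "\<lambda>c. image_mset (\<lambda>(a, b). (c *\<^sub>C a, b))"
  by (rule tensor_eq_scale_left)

definition uminus_tensor :: "('a, 'b) tensor \<Rightarrow> ('a, 'b) tensor" where
  "uminus_tensor t = (- 1) *\<^sub>C t"

definition minus_tensor :: "('a, 'b) tensor \<Rightarrow> ('a, 'b) tensor \<Rightarrow> ('a, 'b) tensor" where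
  "minus_tensor s t = s + (- t)"

lemma tensor_eq_scale_add:
  "tensor_eq (image_mset (\<lambda>(a, b). ((c + d) *\<^sub>C a, b)) X)
     (image_mset (\<lambda>(a, b). (c *\<^sub>C a, b)) X + image_mset (\<lambda>(a, b). (d *\<^sub>C a, b)) X)"
proof (induction X)
  case (add p X)
  obtain a b where p: "p = (a, b)" by force
  show ?case
    using tensor_eq.cong[OF tensor_eq.add_left[of "c *\<^sub>C a" "d *\<^sub>C a" b] add]
    by (simp add: p scaleC_add_left add_mset_commute)
qed (simp add: tensor_eq.refl)

lemma tensor_eq_scale_zero: "tensor_eq (image_mset (\<lambda>(a, b). (0 *\<^sub>C a, b)) X) {#}"
proof (induction X)
  case (add p X)
  then show ?case
    using tensor_eq.cong[OF tensor_eq.zero[of "snd p"] add] by (simp add: case_prod_unfold)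
qed (simp add: tensor_eq.refl)

instance
proof
  fix r s t :: "('a, 'b) tensor" and c d :: complex
  show "r + s + t = r + (s + t)" by transfer (simp add: add.assoc tensor_eq.refl)
  show comm: "s + t = t + s" by transfer (simp add: add.commute tensor_eq.refl)
  show "0 + t = t" by transfer (simp add: tensor_eq.refl)
  show "c *\<^sub>C (s + t) = c *\<^sub>C s + c *\<^sub>C t" by transfer (simp add: tensor_eq.refl)
  show add: "(c + d) *\<^sub>C t = c *\<^sub>C t + d *\<^sub>C t" for c d and t :: "('a, 'b) tensor"
    by transfer (rule tensor_eq_scale_add)
  show "c *\<^sub>C d *\<^sub>C t = (c * d) *\<^sub>C t"
    by transfer (simp add: multiset.map_comp comp_def case_prod_unfold tensor_eq.refl)
  show one: "1 *\<^sub>C t = t" for t :: "('a, 'b) tensor"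
    by transfer (simp add: tensor_eq.refl)
  have zero: "0 *\<^sub>C t = 0" for t :: "('a, 'b) tensor"
    by transfer (rule tensor_eq_scale_zero)
  show "- t + t = 0"
    using add[of "- 1" 1 t] by (simp add: uminus_tensor_def one zero)
  show "s - t = s + - t" by (fact minus_tensor_def)
qed

end

lift_definition tens :: "'a::complex_vector \<Rightarrow> 'b::complex_vector \<Rightarrow> ('a, 'b) tensor"  (infixr "\<otimes>" 76)
  is "\<lambda>a b. {#(a, b)#}" .

text \<open>\<open>tensor_lift f\<close> is the additive map sending \<open>a \<otimes> b\<close> to \<open>f a b\<close>. It is meaningful only for
  balanced biadditive \<open>f\<close>, where it does not depend on the chosen representative. Complex linearity
  of \<open>f\<close> is not needed, so that the antilinear star of a tensor product is also of this form.\<close>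

definition balanced :: "('a::complex_vector \<Rightarrow> 'b::complex_vector \<Rightarrow> 'c::ab_group_add) \<Rightarrow> bool" where
  "balanced f \<longleftrightarrow> (\<forall>a a' b. f (a + a') b = f a b + f a' b) \<and> (\<forall>a b b'. f a (b + b') = f a b + f a b')
     \<and> (\<forall>c a b. f (c *\<^sub>C a) b = f a (c *\<^sub>C b))"

definition tensor_lift ::
    "('a::complex_vector \<Rightarrow> 'b::complex_vector \<Rightarrow> 'c::ab_group_add) \<Rightarrow> ('a, 'b) tensor \<Rightarrow> 'c" where
  "tensor_lift f t = (\<Sum>(a, b)\<in>#rep_tensor t. f a b)"

lemma tensor_eq_sum:
  assumes f: "balanced f"
  shows "tensor_eq X Y \<Longrightarrow> (\<Sum>(a, b)\<in>#X. f a b) = (\<Sum>(a, b)\<in>#Y. f a b)"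
proof (induction rule: tensor_eq.induct)
  case (zero b)
  have "f (0 + 0) b = f 0 b + f 0 b" using f unfolding balanced_def by blast
  then show ?case by simp
qed (use f in \<open>auto simp: balanced_def\<close>)

lemma tensor_lift_abs:
  assumes "balanced f"
  shows "tensor_lift f (abs_tensor X) = (\<Sum>(a, b)\<in>#X. f a b)"
  unfolding tensor_lift_def
  by (intro tensor_eq_sum[OF assms] rep_abs_rsp_left[OF Quotient3_tensor] tensor_eq.refl)

lemma tensor_lift_tens: "balanced f \<Longrightarrow> tensor_lift f (a \<otimes> b) = f a b"
  by (simp add: tens.abs_eq tensor_lift_abs)

lemma tensor_lift_add: "balanced f \<Longrightarrow> tensor_lift f (s + t) = tensor_lift f s + tensor_lift f t"
  by (induct s; induct t) (simp add: plus_tensor.abs_eq tensor_lift_abs)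

definition tensor_map ::
    "('a::complex_vector \<Rightarrow> 'c::complex_vector) \<Rightarrow> ('b::complex_vector \<Rightarrow> 'd::complex_vector)
      \<Rightarrow> ('a, 'b) tensor \<Rightarrow> ('c, 'd) tensor" where
  "tensor_map f g = tensor_lift (\<lambda>a b. f a \<otimes> g b)"

definition tensor_assoc ::
    "(('a::complex_vector, 'b::complex_vector) tensor, 'c::complex_vector) tensor
      \<Rightarrow> ('a, ('b, 'c) tensor) tensor" where
  "tensor_assoc = tensor_lift (\<lambda>t c. tensor_lift (\<lambda>a b. a \<otimes> b \<otimes> c) t)"

definition tensor_mult ::
    "('a::complex_algebra_1, 'b::complex_algebra_1) tensor \<Rightarrow> ('a, 'b) tensor \<Rightarrow> ('a, 'b) tensor" where
  "tensor_mult s t = tensor_lift (\<lambda>a b. tensor_lift (\<lambda>a' b'. (a * a') \<otimes> (b * b')) t) s"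

definition tensor_star ::
    "('a::complex_star_algebra_1, 'b::complex_star_algebra_1) tensor \<Rightarrow> ('a, 'b) tensor" where
  "tensor_star = tensor_lift (\<lambda>a b. star a \<otimes> star b)"

text \<open>Tensor products over a field are exact, so for subspaces \<open>H\<close>, \<open>K\<close> the canonical map from the
  tensor product of \<open>H\<close> and \<open>K\<close> to that of the ambient spaces is injective, with this image.\<close>

definition tensor_subspace ::
    "'a::complex_vector set \<Rightarrow> 'b::complex_vector set \<Rightarrow> ('a, 'b) tensor set" where
  "tensor_subspace H K = complex_vector.span {x \<otimes> y | x y. x \<in> H \<and> y \<in> K}"


section \<open>Hopf algebras\<close>

text \<open>The carrier \<open>H\<close> is a unital subalgebra of the ambient type, and the structure maps are
  given as linear maps on the whole ambient type; all other axioms only concern their restrictions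
  to \<open>H\<close>.\<close>

locale hopf_algebra =
  fixes H :: "'a::complex_algebra_1 set"
    and \<Delta> :: "'a \<Rightarrow> ('a, 'a) tensor"
    and counit :: "'a \<Rightarrow> complex"
    and S :: "'a \<Rightarrow> 'a"
  assumes unital_subalgebra: "unital_subalgebra H"
    and linear_comult: "Vector_Spaces.linear (*\<^sub>C) (*\<^sub>C) \<Delta>"
    and linear_counit: "Vector_Spaces.linear (*\<^sub>C) (*) counit"
    and linear_antipode: "Vector_Spaces.linear (*\<^sub>C) (*\<^sub>C) S"
    and comult_closed: "x \<in> H \<Longrightarrow> \<Delta> x \<in> tensor_subspace H H"
    and antipode_closed: "x \<in> H \<Longrightarrow> S x \<in> H"
    and comult_one: "\<Delta> 1 = 1 \<otimes> 1"
    and comult_mult: "x \<in> H \<Longrightarrow> y \<in> H \<Longrightarrow> \<Delta> (x * y) = tensor_mult (\<Delta> x) (\<Delta> y)"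
    and counit_one: "counit 1 = 1"
    and counit_mult: "x \<in> H \<Longrightarrow> y \<in> H \<Longrightarrow> counit (x * y) = counit x * counit y"
    and coassoc: "x \<in> H \<Longrightarrow> tensor_assoc (tensor_map \<Delta> id (\<Delta> x)) = tensor_map id \<Delta> (\<Delta> x)"
    and counit_left: "x \<in> H \<Longrightarrow> tensor_lift (\<lambda>y z. counit y *\<^sub>C z) (\<Delta> x) = x"
    and counit_right: "x \<in> H \<Longrightarrow> tensor_lift (\<lambda>y z. counit z *\<^sub>C y) (\<Delta> x) = x"
    and antipode_left: "x \<in> H \<Longrightarrow> tensor_lift (\<lambda>y z. S y * z) (\<Delta> x) = counit x *\<^sub>C 1"
    and antipode_right: "x \<in> H \<Longrightarrow> tensor_lift (\<lambda>y z. y * S z) (\<Delta> x) = counit x *\<^sub>C 1"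

locale star_hopf_algebra = hopf_algebra UNIV \<Delta> counit S
  for \<Delta> :: "'a::complex_star_algebra_1 \<Rightarrow> ('a, 'a) tensor"
    and counit :: "'a \<Rightarrow> complex"
    and S :: "'a \<Rightarrow> 'a" +
  assumes comult_star: "\<Delta> (star x) = tensor_star (\<Delta> x)"
    and counit_star: "counit (star x) = cnj (counit x)"


section \<open>Spinor metric and R matrices\<close>

text \<open>Spinor indices have type \<open>2\<close> and the indices 0, 1, 2, 3 have type \<open>4\<close>.\<close>

abbreviation index_sum :: "('i::finite \<Rightarrow> 'a::comm_monoid_add) \<Rightarrow> 'a"  (binder "\<^bold>\<Sum>" 10) where
  "index_sum f \<equiv> sum f UNIV"

datatype pm = Plus | Minus

primrec flip :: "pm \<Rightarrow> pm" where
  "flip Plus = Minus"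
| "flip Minus = Plus"

primrec pm_power :: "real \<Rightarrow> pm \<Rightarrow> real" where
  "pm_power x Plus = x"
| "pm_power x Minus = inverse x"

text \<open>The argument \<open>\<epsilon>\<close> is the matrix with lower undotted indices.
  Conjugation to dotted indices exchanges the two indices.\<close>

definition eps_up :: "complex^2^2 \<Rightarrow> complex^2^2" where
  "eps_up \<epsilon> = matrix_inv \<epsilon>"

definition eps_dot :: "complex^2^2 \<Rightarrow> complex^2^2" where
  "eps_dot \<epsilon> = (\<chi> \<beta> \<alpha>. cnj (\<epsilon> $ \<alpha> $ \<beta>))"

definition eps_dot_up :: "complex^2^2 \<Rightarrow> complex^2^2" where
  "eps_dot_up \<epsilon> = (\<chi> \<beta> \<alpha>. cnj (eps_up \<epsilon> $ \<alpha> $ \<beta>))"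

locale spinor_metric =
  fixes \<epsilon> :: "complex^2^2" and a :: real
  assumes invertible_eps: "invertible \<epsilon>"
    and eps_dot_eq: "eps_dot \<epsilon> $ \<beta> $ \<alpha> = - eps_up \<epsilon> $ \<alpha> $ \<beta>"
    and eps_dot_up_eq: "eps_dot_up \<epsilon> $ \<beta> $ \<alpha> = - \<epsilon> $ \<alpha> $ \<beta>"
    and a_nonzero: "a \<noteq> 0"
    and a_eq: "complex_of_real (a + inverse a) + (\<^bold>\<Sum>\<alpha> \<beta>. eps_up \<epsilon> $ \<alpha> $ \<beta> * \<epsilon> $ \<alpha> $ \<beta>) = 0"

definition Qc :: "real \<Rightarrow> complex" where
  "Qc a = complex_of_real (a + inverse a)"

text \<open>In all R matrices the arguments are the two upper indices followed by the two lower ones.\<close>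

definition Rmat :: "complex^2^2 \<Rightarrow> real \<Rightarrow> pm \<Rightarrow> 2 \<Rightarrow> 2 \<Rightarrow> 2 \<Rightarrow> 2 \<Rightarrow> complex" where
  "Rmat \<epsilon> a s \<alpha> \<beta> \<gamma> \<delta> = of_bool (\<alpha> = \<gamma>) * of_bool (\<beta> = \<delta>)
     + complex_of_real (pm_power a s) * eps_up \<epsilon> $ \<alpha> $ \<beta> * \<epsilon> $ \<gamma> $ \<delta>"

text \<open>Upper indices dotted, undotted; lower indices undotted, dotted.\<close>

definition Rmat_du :: "complex^2^2 \<Rightarrow> real \<Rightarrow> pm \<Rightarrow> 2 \<Rightarrow> 2 \<Rightarrow> 2 \<Rightarrow> 2 \<Rightarrow> complex" where
  "Rmat_du \<epsilon> a s \<delta> \<gamma> \<alpha> \<sigma> = complex_of_real (pm_power (sqrt a) s) * Rmat \<epsilon> a (flip s) \<gamma> \<sigma> \<delta> \<alpha>"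

text \<open>Upper indices undotted, dotted; lower indices dotted, undotted.
  The half-integer power of \<open>a\<close> has the sign opposite to \<open>s\<close>.\<close>

definition Rmat_ud :: "complex^2^2 \<Rightarrow> real \<Rightarrow> pm \<Rightarrow> 2 \<Rightarrow> 2 \<Rightarrow> 2 \<Rightarrow> 2 \<Rightarrow> complex" where
  "Rmat_ud \<epsilon> a s \<gamma> \<delta> \<sigma> \<alpha> = complex_of_real (pm_power (sqrt a) (flip s)) *
     (\<^bold>\<Sum>\<kappa> \<nu>. \<epsilon> $ \<delta> $ \<kappa> * Rmat \<epsilon> a s \<gamma> \<kappa> \<nu> \<alpha> * eps_up \<epsilon> $ \<nu> $ \<sigma>)"


section \<open>Quantum SL(2,C)\<close>

text \<open>\<open>M $ \<alpha> $ \<beta>\<close> has lower index \<open>\<alpha>\<close> and upper index \<open>\<beta>\<close>.\<close>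

definition dotted :: "'a::complex_star_algebra_1^2^2 \<Rightarrow> 'a^2^2" where
  "dotted M = (\<chi> \<alpha> \<beta>. star (M $ \<alpha> $ \<beta>))"

locale quantum_SL2C = spinor_metric \<epsilon> a + star_hopf_algebra \<Delta> counit S
  for \<epsilon> :: "complex^2^2" and a :: real
    and \<Delta> :: "'a::complex_star_algebra_1 \<Rightarrow> ('a, 'a) tensor"
    and counit :: "'a \<Rightarrow> complex"
    and S :: "'a \<Rightarrow> 'a" +
  fixes M :: "'a^2^2"
  assumes generated: "unital_subalgebra hull
        ({M $ \<alpha> $ \<beta> | \<alpha> \<beta>. True} \<union> {dotted M $ \<alpha> $ \<beta> | \<alpha> \<beta>. True}) = UNIV"
    and eps_M_M: "(\<^bold>\<Sum>\<alpha> \<beta>. \<epsilon> $ \<alpha> $ \<beta> *\<^sub>C (M $ \<gamma> $ \<alpha> * M $ \<delta> $ \<beta>)) = \<epsilon> $ \<gamma> $ \<delta> *\<^sub>C 1"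
    and eps_up_M_M: "(\<^bold>\<Sum>\<gamma> \<delta>. eps_up \<epsilon> $ \<gamma> $ \<delta> *\<^sub>C (M $ \<gamma> $ \<alpha> * M $ \<delta> $ \<beta>)) = eps_up \<epsilon> $ \<alpha> $ \<beta> *\<^sub>C 1"
    and eps_dot_M_M: "(\<^bold>\<Sum>\<alpha> \<beta>. eps_dot \<epsilon> $ \<alpha> $ \<beta> *\<^sub>C (dotted M $ \<gamma> $ \<alpha> * dotted M $ \<delta> $ \<beta>))
        = eps_dot \<epsilon> $ \<gamma> $ \<delta> *\<^sub>C 1"
    and eps_dot_up_M_M: "(\<^bold>\<Sum>\<gamma> \<delta>. eps_dot_up \<epsilon> $ \<gamma> $ \<delta> *\<^sub>C (dotted M $ \<gamma> $ \<alpha> * dotted M $ \<delta> $ \<beta>))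
        = eps_dot_up \<epsilon> $ \<alpha> $ \<beta> *\<^sub>C 1"
    and M_dotted_M: "(\<^bold>\<Sum>\<gamma> \<delta>. Rmat_du \<epsilon> a s \<rho> \<beta> \<gamma> \<delta> *\<^sub>C (M $ \<alpha> $ \<gamma> * dotted M $ \<sigma> $ \<delta>))
        = (\<^bold>\<Sum>\<delta> \<gamma>. Rmat_du \<epsilon> a s \<delta> \<gamma> \<alpha> \<sigma> *\<^sub>C (dotted M $ \<delta> $ \<rho> * M $ \<gamma> $ \<beta>))"
    and comult_M: "\<Delta> (M $ \<alpha> $ \<beta>) = (\<^bold>\<Sum>\<gamma>. M $ \<alpha> $ \<gamma> \<otimes> M $ \<gamma> $ \<beta>)"
    and comult_dotted_M: "\<Delta> (dotted M $ \<alpha> $ \<beta>) = (\<^bold>\<Sum>\<gamma>. dotted M $ \<alpha> $ \<gamma> \<otimes> dotted M $ \<gamma> $ \<beta>)"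
    and counit_M: "counit (M $ \<alpha> $ \<beta>) = of_bool (\<alpha> = \<beta>)"
    and counit_dotted_M: "counit (dotted M $ \<alpha> $ \<beta>) = of_bool (\<alpha> = \<beta>)"
    and antipode_M: "S (M $ \<alpha> $ \<beta>)
        = (\<^bold>\<Sum>\<gamma> \<delta>. (\<epsilon> $ \<alpha> $ \<gamma> * eps_up \<epsilon> $ \<delta> $ \<beta>) *\<^sub>C M $ \<delta> $ \<gamma>)"
    and antipode_dotted_M: "S (dotted M $ \<alpha> $ \<beta>)
        = (\<^bold>\<Sum>\<gamma> \<delta>. (eps_dot \<epsilon> $ \<alpha> $ \<gamma> * eps_dot_up \<epsilon> $ \<delta> $ \<beta>) *\<^sub>C dotted M $ \<delta> $ \<gamma>)"


section \<open>Quantum Pauli matrices and metric\<close>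

text \<open>\<open>\<sigma> I $ \<alpha> $ \<beta>\<close> has lower indices: \<open>\<alpha>\<close> undotted, \<open>\<beta>\<close> dotted.\<close>

locale quantum_pauli =
  fixes \<sigma> :: "4 \<Rightarrow> complex^2^2"
  assumes hermitean: "cnj (\<sigma> I $ \<alpha> $ \<beta>) = \<sigma> I $ \<beta> $ \<alpha>"
    and lin_indep: "(\<And>\<alpha> \<beta>. (\<^bold>\<Sum>J. c J * \<sigma> J $ \<alpha> $ \<beta>) = 0) \<Longrightarrow> c I = 0"

text \<open>Upper indices: \<open>\<alpha>\<close> dotted, \<open>\<beta>\<close> undotted.\<close>

definition pauli_bar ::
    "complex^2^2 \<Rightarrow> real \<Rightarrow> (4 \<Rightarrow> complex^2^2) \<Rightarrow> pm \<Rightarrow> 4 \<Rightarrow> 2 \<Rightarrow> 2 \<Rightarrow> complex" where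
  "pauli_bar \<epsilon> a \<sigma> s I \<alpha> \<beta> = (\<^bold>\<Sum>\<kappa> \<tau> \<rho> \<nu>.
     eps_dot_up \<epsilon> $ \<alpha> $ \<kappa> * Rmat_ud \<epsilon> a (flip s) \<tau> \<rho> \<kappa> \<nu> * eps_up \<epsilon> $ \<nu> $ \<beta> * \<sigma> I $ \<tau> $ \<rho>)"

definition metric_up ::
    "complex^2^2 \<Rightarrow> real \<Rightarrow> (4 \<Rightarrow> complex^2^2) \<Rightarrow> pm \<Rightarrow> complex^4^4" where
  "metric_up \<epsilon> a \<sigma> s = (\<chi> I J. 1 / Qc a * (\<^bold>\<Sum>\<alpha> \<nu> \<beta> \<gamma>.
     eps_up \<epsilon> $ \<alpha> $ \<nu> * \<sigma> I $ \<alpha> $ \<beta> * pauli_bar \<epsilon> a \<sigma> s J \<beta> \<gamma> * \<epsilon> $ \<gamma> $ \<nu>))"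

definition metric_low ::
    "complex^2^2 \<Rightarrow> real \<Rightarrow> (4 \<Rightarrow> complex^2^2) \<Rightarrow> pm \<Rightarrow> complex^4^4" where
  "metric_low \<epsilon> a \<sigma> s = matrix_inv (metric_up \<epsilon> a \<sigma> s)"

text \<open>Both signs give the same matrices. The sign is kept as a parameter so that the definition does
  not single out one of them.\<close>

definition pauli_bar_low ::
    "complex^2^2 \<Rightarrow> real \<Rightarrow> (4 \<Rightarrow> complex^2^2) \<Rightarrow> pm \<Rightarrow> 4 \<Rightarrow> 2 \<Rightarrow> 2 \<Rightarrow> complex" where
  "pauli_bar_low \<epsilon> a \<sigma> s I \<alpha> \<beta> = (\<^bold>\<Sum>J. metric_low \<epsilon> a \<sigma> s $ I $ J * pauli_bar \<epsilon> a \<sigma> s J \<alpha> \<beta>)"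

definition pauli_bar_mixed ::
    "complex^2^2 \<Rightarrow> real \<Rightarrow> (4 \<Rightarrow> complex^2^2) \<Rightarrow> pm \<Rightarrow> 4 \<Rightarrow> 2 \<Rightarrow> 2 \<Rightarrow> complex" where
  "pauli_bar_mixed \<epsilon> a \<sigma> s L \<gamma> \<alpha> = (\<^bold>\<Sum>\<delta>. eps_dot \<epsilon> $ \<gamma> $ \<delta> * pauli_bar_low \<epsilon> a \<sigma> s L \<delta> \<alpha>)"

definition pauli_mixed :: "complex^2^2 \<Rightarrow> (4 \<Rightarrow> complex^2^2) \<Rightarrow> 4 \<Rightarrow> 2 \<Rightarrow> 2 \<Rightarrow> complex" where
  "pauli_mixed \<epsilon> \<sigma> K \<tau> \<rho> = (\<^bold>\<Sum>\<beta>. eps_dot_up \<epsilon> $ \<rho> $ \<beta> * \<sigma> K $ \<tau> $ \<beta>)"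


section \<open>Generators of the quantum Lorentz group\<close>

definition lorentz_gen ::
    "complex^2^2 \<Rightarrow> real \<Rightarrow> (4 \<Rightarrow> complex^2^2) \<Rightarrow> 'a::complex_star_algebra_1^2^2 \<Rightarrow> pm \<Rightarrow> 4 \<Rightarrow> 4 \<Rightarrow> 'a"
  where
  "lorentz_gen \<epsilon> a \<sigma> M s L K = (1 / Qc a) *\<^sub>C (\<^bold>\<Sum>\<gamma> \<delta> \<alpha> \<tau> \<rho> \<beta>.
     (eps_dot \<epsilon> $ \<gamma> $ \<delta> * pauli_bar_low \<epsilon> a \<sigma> s L \<delta> \<alpha> * \<sigma> K $ \<tau> $ \<rho> * eps_dot_up \<epsilon> $ \<gamma> $ \<beta>)
       *\<^sub>C (M $ \<alpha> $ \<tau> * dotted M $ \<beta> $ \<rho>))"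

definition lorentz_algebra ::
    "complex^2^2 \<Rightarrow> real \<Rightarrow> (4 \<Rightarrow> complex^2^2) \<Rightarrow> 'a::complex_star_algebra_1^2^2 \<Rightarrow> pm \<Rightarrow> 'a set"
  where
  "lorentz_algebra \<epsilon> a \<sigma> M s = unital_subalgebra hull {lorentz_gen \<epsilon> a \<sigma> M s L K | L K. True}"

end

theory Submission
  imports Defs
begin

text \<open>Write \<open>T\<close> for the matrix \<open>\<epsilon> (\<epsilon>\<^sup>-\<^sup>1)\<^sup>t\<close>, with index placement as in \<open>twist\<close>; its trace is \<open>- Q\<close>.
  Substituting the mixed R matrices into the barred Pauli matrices collapses them to
  \<open>- a\<^sup>s\<^sup>/\<^sup>2 (\<sigma> + a\<^sup>-\<^sup>s tr(T \<sigma>) 1)\<close> with \<open>s = \<plusminus>1\<close> (\<open>pauli_bar_eq\<close>), so the metric is the Gram matrix, in the basis of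
  Pauli matrices, of the bilinear form \<open>b(X, Y) = - a\<^sup>s\<^sup>/\<^sup>2 / Q (tr(T X Y) + a\<^sup>-\<^sup>s tr(T X) tr(T Y))\<close>
  on complex 2 by 2 matrices. This form is nondegenerate, hence the metric is invertible, and the
  barred Pauli matrices with lower index, multiplied by \<open>T / Q\<close>, form the dual basis of the Pauli
  matrices for either sign (\<open>pauli_dual_pauli\<close>, \<open>pauli_pauli_dual\<close>).

  Consequently \<open>\<Lambda> L K\<close> is the coefficient of \<open>\<sigma> L\<close> in the expansion of \<open>M \<sigma>\<^sup>K M\<^sup>*\<close>
  (\<open>lorentz_gen_expansion\<close>): the generators are the tensor product of the spinor corepresentation and
  its conjugate, written in the basis of Pauli matrices. Everything follows from this. The various
  formulas agree because each computes that coefficient. Since the Pauli matrices are hermitean and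
  \<open>M \<sigma>\<^sup>K M\<^sup>*\<close> is so too, the coefficients are real. They form a matrix corepresentation because
  the tensor product is one.

  The form \<open>b\<close> is invariant, \<open>b(M X M\<^sup>*, M Y M\<^sup>*) = b(X, Y)\<close> (\<open>vector_rep_invariant\<close>): its
  coefficients are an R matrix contracted with one upper and one lower spinor metric, so
  the commutation relation exchanges the two middle factors of \<open>M X M\<^sup>* M Y M\<^sup>*\<close> while preserving
  the shape of the coefficients, after which the defining relations of \<open>M\<close> and
  of its conjugate remove all generators. This is the relation for the upper metric. It exhibits a
  left inverse of the matrix \<open>\<Lambda>\<close> with entries in the algebra generated by \<open>\<Lambda>\<close>. In a Hopf algebra
  the antipode is a two-sided inverse of every matrix corepresentation, so this left inverse is
  \<open>S \<Lambda>\<close>; hence the subalgebra is closed under \<open>S\<close>, and the left inverse is also a right inverse,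
  which is the relation for the lower metric.

  Two general facts on \<open>S\<close> are derived along the way: it is antimultiplicative (by uniqueness of
  inverses of matrix corepresentations), and it is injective, as \<open>S\<close> composed with the star is an
  involution on the generators. Injectivity gives meaning to \<open>inv S\<close>.\<close>


section \<open>Multilinear algebra of the tensor product\<close>

lemma tens_add_left: "(a + a') \<otimes> b = a \<otimes> b + a' \<otimes> b"
proof -
  have "(a + a') \<otimes> b = abs_tensor {#(a, b), (a', b)#}"
    by (simp add: tens.abs_eq tensor.abs_eq_iff tensor_eq.add_left)
  then show ?thesis by (simp add: tens.abs_eq plus_tensor.abs_eq add_mset_commute)
qed

lemma tens_add_right: "a \<otimes> (b + b') = a \<otimes> b + a \<otimes> b'"
proof -
  have "a \<otimes> (b + b') = abs_tensor {#(a, b), (a, b')#}"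
    by (simp add: tens.abs_eq tensor.abs_eq_iff tensor_eq.add_right)
  then show ?thesis by (simp add: tens.abs_eq plus_tensor.abs_eq add_mset_commute)
qed

lemma tens_scaleC_left: "(c *\<^sub>C a) \<otimes> b = c *\<^sub>C (a \<otimes> b)"
  by transfer (simp add: tensor_eq.refl)

lemma tens_scaleC_right: "a \<otimes> (c *\<^sub>C b) = c *\<^sub>C (a \<otimes> b)"
proof -
  have "(c *\<^sub>C a) \<otimes> b = a \<otimes> (c *\<^sub>C b)"
    by transfer (rule tensor_eq.scale)
  then show ?thesis by (simp add: tens_scaleC_left)
qed

lemma tens_sum_left: "(\<Sum>i\<in>I. f i) \<otimes> b = (\<Sum>i\<in>I. f i \<otimes> b)"
  by (rule additive.sum) (simp add: Modules.additive_def tens_add_left)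

lemma tens_sum_right: "a \<otimes> (\<Sum>i\<in>I. f i) = (\<Sum>i\<in>I. a \<otimes> f i)"
  by (rule additive.sum) (simp add: Modules.additive_def tens_add_right)

lemma tensor_induct [case_names tens add]:
  assumes tens: "\<And>a b. P (a \<otimes> b)" and add: "\<And>s t. P s \<Longrightarrow> P t \<Longrightarrow> P (s + t)"
  shows "P t"
proof (induct t)
  case (1 X)
  show ?case
  proof (induction X)
    case empty
    have "(0 :: 'a) \<otimes> (0 :: 'b) = 0"
      using tens_add_left[of 0 0 0] by simp
    then show ?case
      using tens[of 0 0] by (simp add: zero_tensor.abs_eq)
  next
    case (add p X)
    have "abs_tensor (add_mset p X) = fst p \<otimes> snd p + abs_tensor X"
      by (simp add: tens.abs_eq plus_tensor.abs_eq)
    then show ?case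
      using assms(2)[OF tens add] by simp
  qed
qed

lemma tensor_lift_sum:
  assumes "balanced f"
  shows "tensor_lift f (\<Sum>i\<in>I. t i) = (\<Sum>i\<in>I. tensor_lift f (t i))"
  by (rule additive.sum) (simp add: Modules.additive_def tensor_lift_add assms)

lemma balanced_tens_mult:
  "balanced (\<lambda>a' b'. (a * a') \<otimes> (b * b') :: ('a::complex_algebra_1, 'b::complex_algebra_1) tensor)"
  by (simp add: balanced_def distrib_left tens_add_left tens_add_right mult_scaleC_right
      tens_scaleC_left tens_scaleC_right)

lemma tensor_lift_plus:
  assumes "balanced f" "balanced g"
  shows "tensor_lift (\<lambda>a b. f a b + g a b) t = tensor_lift f t + tensor_lift g t"
proof -
  have "balanced (\<lambda>a b. f a b + g a b)"
    using assms by (simp add: balanced_def)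
  with assms show ?thesis
    by (induction t rule: tensor_induct) (simp_all add: tensor_lift_tens tensor_lift_add)
qed

lemma balanced_tensor_mult:
  "balanced (\<lambda>a b. tensor_lift (\<lambda>a' b'. (a * a') \<otimes> (b * b')) t
     :: ('a::complex_algebra_1, 'b::complex_algebra_1) tensor)"
  unfolding balanced_def
  by (simp add: distrib_right tens_add_left tens_add_right tensor_lift_plus
      balanced_tens_mult mult_scaleC_left tens_scaleC_left tens_scaleC_right)

lemma tensor_mult_tens: "tensor_mult (a \<otimes> b) (a' \<otimes> b') = (a * a') \<otimes> (b * b')"
  unfolding tensor_mult_def
  by (subst tensor_lift_tens[OF balanced_tensor_mult], rule tensor_lift_tens[OF balanced_tens_mult])

lemma tensor_mult_add_left: "tensor_mult (s + s') t = tensor_mult s t + tensor_mult s' t"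
  by (simp add: tensor_mult_def tensor_lift_add balanced_tensor_mult)

lemma tensor_mult_add_right: "tensor_mult s (t + t') = tensor_mult s t + tensor_mult s t'"
proof (induction s rule: tensor_induct)
  case (tens a b)
  show ?case
    unfolding tensor_mult_def tensor_lift_tens[OF balanced_tensor_mult]
    by (rule tensor_lift_add[OF balanced_tens_mult])
qed (simp add: tensor_mult_add_left)

lemma tensor_mult_scaleC_left: "tensor_mult (c *\<^sub>C s) t = c *\<^sub>C tensor_mult s t"
proof (induction s rule: tensor_induct)
  case (tens a b)
  show ?case
    by (induction t rule: tensor_induct)
      (simp_all add: tensor_mult_tens tensor_mult_add_right scaleC_add_right mult_scaleC_left
        flip: tens_scaleC_left)
qed (simp add: tensor_mult_add_left scaleC_add_right)

lemma tensor_mult_scaleC_right: "tensor_mult s (c *\<^sub>C t) = c *\<^sub>C tensor_mult s t"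
proof (induction t rule: tensor_induct)
  case (tens a b)
  show ?case
    by (induction s rule: tensor_induct)
      (simp_all add: tensor_mult_tens tensor_mult_add_left scaleC_add_right mult_scaleC_right
        flip: tens_scaleC_left)
qed (simp add: tensor_mult_add_right scaleC_add_right)

lemma tensor_mult_sum:
  "tensor_mult (\<Sum>i\<in>I. s i) (\<Sum>j\<in>J. t j) = (\<Sum>i\<in>I. \<Sum>j\<in>J. tensor_mult (s i) (t j))"
proof -
  have "tensor_mult (\<Sum>i\<in>I. s i) u = (\<Sum>i\<in>I. tensor_mult (s i) u)" for u
    by (rule additive.sum) (simp add: Modules.additive_def tensor_mult_add_left)
  moreover have "tensor_mult u (\<Sum>j\<in>J. t j) = (\<Sum>j\<in>J. tensor_mult u (t j))" for u
    by (rule additive.sum) (simp add: Modules.additive_def tensor_mult_add_right)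
  ultimately show ?thesis by (simp only: sum.swap[of _ I])
qed

lemma subspace_tensor_subspace: "complex_vector.subspace (tensor_subspace H K)"
  by (simp add: tensor_subspace_def complex_vector.subspace_span)

lemma tens_in_tensor_subspace: "x \<in> H \<Longrightarrow> y \<in> K \<Longrightarrow> x \<otimes> y \<in> tensor_subspace H K"
  unfolding tensor_subspace_def by (rule complex_vector.span_base) blast

lemma tensor_mult_in_tensor_subspace:
  assumes H: "\<And>x y. x \<in> H \<Longrightarrow> y \<in> H \<Longrightarrow> x * y \<in> H"
    and K: "\<And>x y. x \<in> K \<Longrightarrow> y \<in> K \<Longrightarrow> x * y \<in> K"
    and s: "s \<in> tensor_subspace H K" and t: "t \<in> tensor_subspace H K"
  shows "tensor_mult s t \<in> tensor_subspace H K"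
proof -
  note sub = subspace_tensor_subspace[of H K]
  have 0: "tensor_mult 0 u = 0" "tensor_mult u 0 = 0" for u :: "('a, 'b) tensor"
    using tensor_mult_add_left[of 0 0 u] tensor_mult_add_right[of u 0 0] by simp_all
  have *: "tensor_mult (a \<otimes> b) t \<in> tensor_subspace H K" if "a \<in> H" "b \<in> K" for a b
    using t unfolding tensor_subspace_def[of H K]
  proof (rule complex_vector.span_induct)
    show "complex_vector.subspace {u. tensor_mult (a \<otimes> b) u \<in> complex_vector.span {x \<otimes> y |x y. x \<in> H \<and> y \<in> K}}"
      using sub unfolding complex_vector.subspace_def tensor_subspace_def
      by (simp add: 0 tensor_mult_add_right tensor_mult_scaleC_right)
  qed (use that H K in \<open>auto simp: tensor_mult_tens intro!: complex_vector.span_base\<close>, blast)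
  show ?thesis
    using s unfolding tensor_subspace_def[of H K]
  proof (rule complex_vector.span_induct)
    show "complex_vector.subspace {u. tensor_mult u t \<in> complex_vector.span {x \<otimes> y |x y. x \<in> H \<and> y \<in> K}}"
      using sub unfolding complex_vector.subspace_def tensor_subspace_def
      by (simp add: 0 tensor_mult_add_left tensor_mult_scaleC_left)
  qed (use * in \<open>auto simp: tensor_subspace_def\<close>)
qed


section \<open>Matrix corepresentations of a Hopf algebra\<close>

lemma unital_subalgebra_hull: "unital_subalgebra (unital_subalgebra hull G)"
  by (rule hull_in) (auto simp: unital_subalgebra_def)

lemma unital_subalgebra_subspace:
  assumes "unital_subalgebra B"
  shows "complex_vector.subspace B"
proof -
  have "0 *\<^sub>C 1 \<in> B" using assms unfolding unital_subalgebra_def by blast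
  then show ?thesis
    using assms by (auto simp: unital_subalgebra_def complex_vector.subspace_def)
qed

context hopf_algebra
begin

text \<open>Linearity is restated instead of being obtained by a permanent interpretation: for the
  counit the scalar multiplication is the product of complex numbers, and the simplification rules
  of the interpretation would reassociate products to the left, against the usual normal form.\<close>

lemma comult_add: "\<Delta> (x + y) = \<Delta> x + \<Delta> y"
  and comult_scaleC: "\<Delta> (c *\<^sub>C x) = c *\<^sub>C \<Delta> x"
  and comult_sum: "\<Delta> (\<Sum>i\<in>I. f i) = (\<Sum>i\<in>I. \<Delta> (f i))"
proof -
  interpret Vector_Spaces.linear "(*\<^sub>C)" "(*\<^sub>C)" \<Delta>
    by (rule linear_comult)
  show "\<Delta> (x + y) = \<Delta> x + \<Delta> y" "\<Delta> (c *\<^sub>C x) = c *\<^sub>C \<Delta> x"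
    "\<Delta> (\<Sum>i\<in>I. f i) = (\<Sum>i\<in>I. \<Delta> (f i))"
    by (rule add, rule scale, rule sum)
qed

lemma counit_scaleC: "counit (c *\<^sub>C x) = c * counit x"
  and counit_sum: "counit (\<Sum>i\<in>I. f i) = (\<Sum>i\<in>I. counit (f i))"
proof -
  interpret Vector_Spaces.linear "(*\<^sub>C)" "(*)" counit
    by (rule linear_counit)
  show "counit (c *\<^sub>C x) = c * counit x"
    "counit (\<Sum>i\<in>I. f i) = (\<Sum>i\<in>I. counit (f i))"
    by (rule scale, rule sum)
qed

lemma antipode_add: "S (x + y) = S x + S y"
  and antipode_scaleC: "S (c *\<^sub>C x) = c *\<^sub>C S x"
  and antipode_sum: "S (\<Sum>i\<in>I. f i) = (\<Sum>i\<in>I. S (f i))"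
proof -
  interpret Vector_Spaces.linear "(*\<^sub>C)" "(*\<^sub>C)" S
    by (rule linear_antipode)
  show "S (x + y) = S x + S y" "S (c *\<^sub>C x) = c *\<^sub>C S x"
    "S (\<Sum>i\<in>I. f i) = (\<Sum>i\<in>I. S (f i))"
    by (rule add, rule scale, rule sum)
qed

lemma antipode_zero: "S 0 = 0"
  using antipode_scaleC[of 0 0] by simp

text \<open>Entries of a corepresentation matrix generate enough of a Hopf algebra to avoid computations
  with iterated coproducts: on them, the antipode axioms are statements on inverse matrices.\<close>

definition corep :: "'i set \<Rightarrow> ('i \<Rightarrow> 'i \<Rightarrow> 'a) \<Rightarrow> bool" where
  "corep I X \<longleftrightarrow> finite I \<and> (\<forall>i\<in>I. \<forall>j\<in>I. X i j \<in> H
     \<and> \<Delta> (X i j) = (\<Sum>k\<in>I. X i k \<otimes> X k j) \<and> counit (X i j) = of_bool (i = j))"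

lemma balanced_antipode_left: "balanced (\<lambda>y z. S y * z)"
  by (simp add: balanced_def antipode_add antipode_scaleC distrib_left distrib_right
      mult_scaleC_left mult_scaleC_right)

lemma balanced_antipode_right: "balanced (\<lambda>y z. y * S z)"
  by (simp add: balanced_def antipode_add antipode_scaleC distrib_left distrib_right
      mult_scaleC_left mult_scaleC_right)

lemma corep_antipode:
  assumes "corep I X" "i \<in> I" "j \<in> I"
  shows "(\<Sum>k\<in>I. S (X i k) * X k j) = of_bool (i = j)"
    and "(\<Sum>k\<in>I. X i k * S (X k j)) = of_bool (i = j)"
proof -
  have X: "X i j \<in> H" "\<Delta> (X i j) = (\<Sum>k\<in>I. X i k \<otimes> X k j)" "counit (X i j) = of_bool (i = j)"
    using assms by (auto simp: corep_def)
  show "(\<Sum>k\<in>I. S (X i k) * X k j) = of_bool (i = j)"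
    using antipode_left[OF X(1)] X(2,3)
    by (simp add: tensor_lift_sum tensor_lift_tens balanced_antipode_left scaleC_one split: if_splits)
  show "(\<Sum>k\<in>I. X i k * S (X k j)) = of_bool (i = j)"
    using antipode_right[OF X(1)] X(2,3)
    by (simp add: tensor_lift_sum tensor_lift_tens balanced_antipode_right scaleC_one split: if_splits)
qed

text \<open>One-sided inverses of a matrix that has a two-sided one are unique, and by the antipode axioms
  the antipode inverts a corepresentation matrix.\<close>

lemma antipode_eq_left_inverse:
  assumes X: "corep I X" and i: "i \<in> I" and j: "j \<in> I"
    and W: "\<And>j. j \<in> I \<Longrightarrow> (\<Sum>k\<in>I. W i k * X k j) = of_bool (i = j)"
  shows "S (X i j) = W i j"
proof -
  have fin: "finite I" using X by (simp add: corep_def)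
  have "W i j = (\<Sum>k\<in>I. W i k * of_bool (k = j))"
    using fin j by (simp add: of_bool_def if_distrib cong: if_cong)
  also have "\<dots> = (\<Sum>k\<in>I. W i k * (\<Sum>l\<in>I. X k l * S (X l j)))"
    using corep_antipode(2)[OF X _ j] by simp
  also have "\<dots> = (\<Sum>l\<in>I. (\<Sum>k\<in>I. W i k * X k l) * S (X l j))"
    unfolding sum_distrib_left sum_distrib_right by (subst sum.swap) (simp add: mult.assoc)
  also have "\<dots> = (\<Sum>l\<in>I. of_bool (i = l) * S (X l j))"
    using W by simp
  also have "\<dots> = S (X i j)"
    using fin i by (simp add: of_bool_def if_distrib if_distribR cong: if_cong)
  finally show ?thesis ..
qed

lemma corep_product:
  assumes X: "corep I X" and Y: "corep J Y"
  shows "corep (I \<times> J) (\<lambda>p q. X (fst p) (fst q) * Y (snd p) (snd q))"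
proof -
  have "\<Delta> (X i j * Y i' j') = (\<Sum>p\<in>I \<times> J. (X i (fst p) * Y i' (snd p)) \<otimes> (X (fst p) j * Y (snd p) j'))"
    if "i \<in> I" "j \<in> I" "i' \<in> J" "j' \<in> J" for i j i' j'
  proof -
    have "\<Delta> (X i j * Y i' j') = tensor_mult (\<Delta> (X i j)) (\<Delta> (Y i' j'))"
      using that X Y by (intro comult_mult) (auto simp: corep_def)
    also have "\<dots> = (\<Sum>k\<in>I. \<Sum>k'\<in>J. (X i k * Y i' k') \<otimes> (X k j * Y k' j'))"
      using that X Y by (simp add: corep_def tensor_mult_sum tensor_mult_tens)
    finally show ?thesis by (simp add: sum.cartesian_product case_prod_unfold)
  qed
  moreover have "X i j * Y i' j' \<in> H \<and> counit (X i j * Y i' j') = of_bool (i = j) * of_bool (i' = j')"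
    if "i \<in> I" "j \<in> I" "i' \<in> J" "j' \<in> J" for i j i' j'
    using that X Y unital_subalgebra by (auto simp: corep_def counit_mult unital_subalgebra_def)
  ultimately show ?thesis
    using X Y unfolding corep_def by (auto simp: prod_eq_iff)
qed

text \<open>The product of two corepresentations has \<open>S Y S X\<close> as a left inverse, as the inner factors
  cancel first, then the outer ones.\<close>

lemma antipode_mult_corep:
  assumes X: "corep I X" and Y: "corep J Y" and ij: "i \<in> I" "j \<in> I" "i' \<in> J" "j' \<in> J"
  shows "S (X i j * Y i' j') = S (Y i' j') * S (X i j)"
proof -
  have "(\<Sum>k\<in>I \<times> J. S (Y i' (snd k)) * S (X i (fst k)) * (X (fst k) (fst q) * Y (snd k) (snd q)))
      = of_bool ((i, i') = q)" if "q \<in> I \<times> J" for q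
  proof -
    have fin: "finite I" using X by (simp add: corep_def)
    have "(\<Sum>k\<in>I \<times> J. S (Y i' (snd k)) * S (X i (fst k)) * (X (fst k) (fst q) * Y (snd k) (snd q)))
       = (\<Sum>k'\<in>J. \<Sum>k\<in>I. S (Y i' k') * (S (X i k) * X k (fst q)) * Y k' (snd q))"
      by (subst sum.swap) (simp add: sum.cartesian_product case_prod_unfold mult.assoc)
    also have "\<dots> = (\<Sum>k'\<in>J. S (Y i' k') * (\<Sum>k\<in>I. S (X i k) * X k (fst q)) * Y k' (snd q))"
      by (simp add: sum_distrib_left sum_distrib_right)
    also have "\<dots> = of_bool (i = fst q) * (\<Sum>k'\<in>J. S (Y i' k') * Y k' (snd q))"
      using that ij corep_antipode(1)[OF X, of i "fst q"] by auto
    also have "\<dots> = of_bool ((i, i') = q)"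
      using that ij corep_antipode(1)[OF Y, of i' "snd q"] by auto
    finally show ?thesis .
  qed
  from antipode_eq_left_inverse[OF corep_product[OF X Y],
      of "(i, i')" "(j, j')" "\<lambda>p q. S (Y (snd p) (snd q)) * S (X (fst p) (fst q))"] this ij
  show ?thesis by simp
qed

text \<open>Every finite index set can be renamed to one of natural numbers, so restricting the index
  type loses no coefficients.\<close>

definition corep_coeffs :: "'a set" where
  "corep_coeffs = {X i j | (I :: nat set) X i j. corep I X \<and> i \<in> I \<and> j \<in> I}"

lemma corep_coeffsI:
  assumes X: "corep I X" and ij: "i \<in> I" "j \<in> I"
  shows "X i j \<in> corep_coeffs"
proof -
  obtain h where h: "bij_betw h {0..<card I} I"
    using X ex_bij_betw_nat_finite unfolding corep_def by blast
  have mem: "p < card I \<Longrightarrow> h p \<in> I" for p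
    using h by (auto simp: bij_betw_def)
  have eq: "p < card I \<Longrightarrow> q < card I \<Longrightarrow> h p = h q \<longleftrightarrow> p = q" for p q
    using h by (auto simp: bij_betw_def inj_on_def)
  have "corep {0..<card I} (\<lambda>p q. X (h p) (h q))"
    using X unfolding corep_def
    by (auto simp: mem eq sum.reindex_bij_betw[OF h, of "\<lambda>k. X _ k \<otimes> X k _"])
  moreover obtain p q where "p \<in> {0..<card I}" "q \<in> {0..<card I}" "h p = i" "h q = j"
    using h ij by (metis bij_betw_def imageE)
  ultimately have "\<exists>p q. X i j = X (h p) (h q) \<and> corep {0..<card I} (\<lambda>p q. X (h p) (h q))
      \<and> p \<in> {0..<card I} \<and> q \<in> {0..<card I}"
    by metis
  then show ?thesis
    unfolding corep_coeffs_def by (intro CollectI exI[of _ "{0..<card I}"] exI[of _ "\<lambda>p q. X (h p) (h q)"])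
qed

lemma corep_coeffs_mult:
  assumes "x \<in> corep_coeffs" "y \<in> corep_coeffs"
  shows "x * y \<in> corep_coeffs"
proof -
  obtain I :: "nat set" and X i j where X: "corep I X" "i \<in> I" "j \<in> I" "x = X i j"
    using assms(1) unfolding corep_coeffs_def by blast
  obtain J :: "nat set" and Y k l where Y: "corep J Y" "k \<in> J" "l \<in> J" "y = Y k l"
    using assms(2) unfolding corep_coeffs_def by blast
  show ?thesis
    using corep_coeffsI[OF corep_product[OF X(1) Y(1)], of "(i, k)" "(j, l)"] X Y by simp
qed

lemma corep_one: "corep {()} (\<lambda>_ _. 1)"
  using unital_subalgebra by (simp add: corep_def comult_one counit_one unital_subalgebra_def)

lemma unital_subalgebra_span_corep_coeffs:
  "unital_subalgebra (complex_vector.span corep_coeffs)"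
proof -
  let ?V = "complex_vector.span corep_coeffs"
  have 1: "x * y \<in> ?V" if "x \<in> corep_coeffs" "y \<in> ?V" for x y
    using that(2)
  proof (rule complex_vector.span_induct)
    show "complex_vector.subspace {y. x * y \<in> ?V}"
      using complex_vector.subspace_span[of corep_coeffs] unfolding complex_vector.subspace_def
      by (simp add: distrib_left mult_scaleC_right)
  qed (use that(1) in \<open>simp add: corep_coeffs_mult complex_vector.span_base\<close>)
  have 2: "x * y \<in> ?V" if "x \<in> ?V" "y \<in> ?V" for x y
    using that(1)
  proof (rule complex_vector.span_induct)
    show "complex_vector.subspace {x. x * y \<in> ?V}"
      using complex_vector.subspace_span[of corep_coeffs] unfolding complex_vector.subspace_def
      by (simp add: distrib_right mult_scaleC_left)
  qed (use that(2) 1 in simp)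
  have "1 \<in> ?V"
    using corep_coeffsI[OF corep_one] by (simp add: complex_vector.span_base)
  with 2 show ?thesis
    by (simp add: unital_subalgebra_def complex_vector.span_add complex_vector.span_scale)
qed

text \<open>Coefficients of corepresentations are closed under products, so their span is a subalgebra;
  once it contains generators it is everything, and antimultiplicativity extends by bilinearity.\<close>

lemma antipode_mult:
  assumes G: "G \<subseteq> corep_coeffs" and gen: "unital_subalgebra hull G = H" and xy: "x \<in> H" "y \<in> H"
  shows "S (x * y) = S y * S x"
proof -
  have H: "H \<subseteq> complex_vector.span corep_coeffs"
    using gen hull_minimal[of G "complex_vector.span corep_coeffs" unital_subalgebra]
      G complex_vector.span_superset unital_subalgebra_span_corep_coeffs by blast
  have 1: "S (x * y) = S y * S x" if x: "x \<in> corep_coeffs" and y: "y \<in> corep_coeffs" for x y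
  proof -
    obtain I :: "nat set" and X i j where X: "corep I X" "i \<in> I" "j \<in> I" "x = X i j"
      using x unfolding corep_coeffs_def by blast
    obtain J :: "nat set" and Y k l where Y: "corep J Y" "k \<in> J" "l \<in> J" "y = Y k l"
      using y unfolding corep_coeffs_def by blast
    show ?thesis
      using antipode_mult_corep[OF X(1) Y(1)] X Y by simp
  qed
  have 2: "S (x * y) = S y * S x" if x: "x \<in> corep_coeffs" and y: "y \<in> complex_vector.span corep_coeffs" for x y
    using y
  proof (rule complex_vector.span_induct)
    show "complex_vector.subspace {y. S (x * y) = S y * S x}"
      unfolding complex_vector.subspace_def
      by (simp add: distrib_left distrib_right mult_scaleC_left mult_scaleC_right antipode_zero antipode_add antipode_scaleC)
  qed (use x 1 in simp)
  have 3: "S (x * y) = S y * S x" if y: "y \<in> complex_vector.span corep_coeffs"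
    and x: "x \<in> complex_vector.span corep_coeffs" for x y
    using x
  proof (rule complex_vector.span_induct)
    show "complex_vector.subspace {x. S (x * y) = S y * S x}"
      unfolding complex_vector.subspace_def
      by (simp add: distrib_left distrib_right mult_scaleC_left mult_scaleC_right antipode_zero antipode_add antipode_scaleC)
  qed (use y 2 in simp)
  show ?thesis using 3 H xy by blast
qed

text \<open>All equational axioms are inherited; only closure under coproduct and antipode is at stake,
  and it suffices on generators because both maps respect products, the antipode up to order.\<close>

lemma hopf_subalgebra:
  assumes X: "corep I X" and L: "L = unital_subalgebra hull {X i j | i j. i \<in> I \<and> j \<in> I}"
    and antipode: "\<And>i j. i \<in> I \<Longrightarrow> j \<in> I \<Longrightarrow> S (X i j) \<in> L"
    and antimult: "\<And>x y. x \<in> H \<Longrightarrow> y \<in> H \<Longrightarrow> S (x * y) = S y * S x"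
  shows "hopf_algebra L \<Delta> counit S"
proof -
  have sub: "unital_subalgebra L"
    unfolding L by (rule unital_subalgebra_hull)
  have minimal: "L \<subseteq> B" if "{X i j | i j. i \<in> I \<and> j \<in> I} \<subseteq> B" "unital_subalgebra B" for B
    unfolding L using that by (rule hull_minimal)
  have LH: "L \<subseteq> H"
    using X unital_subalgebra by (intro minimal) (auto simp: corep_def)
  have gens: "X i j \<in> L" if "i \<in> I" "j \<in> I" for i j
    unfolding L using that by (intro hull_inc) auto
  have S1: "S 1 = 1"
    using corep_antipode(1)[OF corep_one] by simp
  let ?T = "tensor_subspace L L"
  note T = subspace_tensor_subspace[of L L]
  have "L \<subseteq> {x \<in> L. \<Delta> x \<in> ?T}"
  proof (rule minimal)
    show "{X i j |i j. i \<in> I \<and> j \<in> I} \<subseteq> {x \<in> L. \<Delta> x \<in> ?T}"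
      using X gens by (auto simp: corep_def intro!: complex_vector.subspace_sum[OF T] tens_in_tensor_subspace)
    show "unital_subalgebra {x \<in> L. \<Delta> x \<in> ?T}"
      using sub LH T unfolding unital_subalgebra_def
      by (auto simp: comult_one comult_add comult_scaleC comult_mult subsetD
        intro!: tens_in_tensor_subspace tensor_mult_in_tensor_subspace
          complex_vector.subspace_add complex_vector.subspace_scale)
  qed
  moreover have "L \<subseteq> {x \<in> L. S x \<in> L}"
  proof (rule minimal)
    show "{X i j |i j. i \<in> I \<and> j \<in> I} \<subseteq> {x \<in> L. S x \<in> L}"
      using antipode gens by auto
    show "unital_subalgebra {x \<in> L. S x \<in> L}"
      using sub LH unfolding unital_subalgebra_def
      by (auto simp: S1 antipode_add antipode_scaleC antimult subsetD)
  qed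
  ultimately show ?thesis
    using LH sub
    by (intro hopf_algebra.intro)
      (auto simp: comult_one comult_mult counit_one counit_mult coassoc counit_left counit_right
        antipode_left antipode_right subsetD linear_comult linear_counit linear_antipode)
qed

end

section \<open>The invariant form on spinor matrices\<close>

lemma sum_pair: "(\<Sum>p\<in>UNIV. f p) = (\<Sum>i\<in>UNIV. \<Sum>j\<in>UNIV. f (i, j))"
  for f :: "'i::finite \<times> 'j::finite \<Rightarrow> 'a::comm_monoid_add"
  by (simp add: sum.cartesian_product case_prod_unfold flip: UNIV_Times_UNIV)

lemma sum_of_bool:
  fixes f :: "'i::finite \<Rightarrow> 'a::semiring_1"
  shows "(\<Sum>i\<in>UNIV. of_bool (i = j) * f i) = f j" "(\<Sum>i\<in>UNIV. of_bool (j = i) * f i) = f j"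
    "(\<Sum>i\<in>UNIV. f i * of_bool (i = j)) = f j" "(\<Sum>i\<in>UNIV. f i * of_bool (j = i)) = f j"
  by (simp_all add: of_bool_def if_distrib if_distribR cong: if_cong)

lemma matrix_inv_inverse:
  assumes "invertible A"
  shows "A ** matrix_inv A = mat 1" "matrix_inv A ** A = mat 1"
  using someI_ex[OF assms[unfolded invertible_def]] by (simp_all add: matrix_inv_def)

lemma invertible_of_left_kernel:
  fixes A :: "'a::field^'n^'n"
  assumes "\<And>v. transpose A *v v = 0 \<Longrightarrow> v = 0"
  shows "invertible A"
  using assms matrix_left_invertible_ker[of "transpose A"]
  by (auto simp: left_invertible_transpose invertible_right_inverse)

text \<open>By the reality condition on \<open>\<epsilon>\<close> this is \<open>- \<epsilon> \<epsilon>\<^sup>\<dagger>\<close>. It is \<open>- 1\<close> when \<open>\<epsilon>\<close> is antisymmetric,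
  as in the undeformed case, and otherwise makes the traces below quantum traces.\<close>

definition twist :: "complex^2^2 \<Rightarrow> 2 \<Rightarrow> 2 \<Rightarrow> complex" where
  "twist \<epsilon> \<rho> \<tau> = (\<^bold>\<Sum>\<nu>. \<epsilon> $ \<rho> $ \<nu> * eps_up \<epsilon> $ \<tau> $ \<nu>)"

definition form_scale :: "real \<Rightarrow> pm \<Rightarrow> complex" where
  "form_scale a s = - complex_of_real (pm_power (sqrt a) s) / Qc a"

text \<open>The form \<open>b\<close> of the introduction on matrix units: pairs of indices stand for the undotted and
  the dotted index of a matrix, and \<open>b(X, Y)\<close> is the sum of \<open>spinor_form \<epsilon> a s p q\<close> times the entries
  of \<open>X\<close> at \<open>p\<close> and of \<open>Y\<close> at \<open>q\<close>.\<close>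

definition spinor_form :: "complex^2^2 \<Rightarrow> real \<Rightarrow> pm \<Rightarrow> 2 \<times> 2 \<Rightarrow> 2 \<times> 2 \<Rightarrow> complex" where
  "spinor_form \<epsilon> a s p q = form_scale a s *
     (twist \<epsilon> (snd q) (fst p) * of_bool (snd p = fst q)
      + complex_of_real (pm_power a (flip s)) * twist \<epsilon> (snd p) (fst p) * twist \<epsilon> (snd q) (fst q))"

abbreviation entry :: "'c^2^2 \<Rightarrow> 2 \<times> 2 \<Rightarrow> 'c" where
  "entry A p \<equiv> A $ fst p $ snd p"

context spinor_metric
begin

lemma eps_eps_up: "(\<^bold>\<Sum>\<gamma>. \<epsilon> $ \<alpha> $ \<gamma> * eps_up \<epsilon> $ \<gamma> $ \<beta>) = of_bool (\<alpha> = \<beta>)"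
  and eps_up_eps: "(\<^bold>\<Sum>\<gamma>. eps_up \<epsilon> $ \<alpha> $ \<gamma> * \<epsilon> $ \<gamma> $ \<beta>) = of_bool (\<alpha> = \<beta>)"
proof -
  have "\<epsilon> ** eps_up \<epsilon> = mat 1" "eps_up \<epsilon> ** \<epsilon> = mat 1"
    using matrix_inv_inverse[OF invertible_eps] by (simp_all add: eps_up_def)
  then show "(\<^bold>\<Sum>\<gamma>. \<epsilon> $ \<alpha> $ \<gamma> * eps_up \<epsilon> $ \<gamma> $ \<beta>) = of_bool (\<alpha> = \<beta>)"
    "(\<^bold>\<Sum>\<gamma>. eps_up \<epsilon> $ \<alpha> $ \<gamma> * \<epsilon> $ \<gamma> $ \<beta>) = of_bool (\<alpha> = \<beta>)"
    by (simp_all add: matrix_matrix_mult_def mat_def vec_eq_iff)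
qed

lemma Qc_nonzero: "Qc a \<noteq> 0"
proof -
  have "a * (a + inverse a) = a\<^sup>2 + 1"
    using a_nonzero by (simp add: power2_eq_square distrib_left)
  moreover have "a\<^sup>2 + 1 \<noteq> 0"
    using zero_le_power2[of a] by linarith
  ultimately have "a + inverse a \<noteq> 0" by auto
  then show ?thesis unfolding Qc_def by (metis of_real_eq_0_iff)
qed

lemma form_scale_nonzero: "form_scale a s \<noteq> 0"
  using a_nonzero Qc_nonzero by (cases s) (simp_all add: form_scale_def)

lemma trace_twist: "(\<^bold>\<Sum>\<rho>. twist \<epsilon> \<rho> \<rho>) = - Qc a"
  using a_eq unfolding twist_def Qc_def eq_neg_iff_add_eq_0 by (simp only: mult.commute add.commute)

lemma twist_left_inverse:
  "(\<^bold>\<Sum>\<gamma>. (\<^bold>\<Sum>\<mu>. \<epsilon> $ \<mu> $ \<kappa> * eps_up \<epsilon> $ \<mu> $ \<gamma>) * twist \<epsilon> \<gamma> \<alpha>) = of_bool (\<kappa> = \<alpha>)"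
proof -
  have "(\<^bold>\<Sum>\<gamma>. (\<^bold>\<Sum>\<mu>. \<epsilon> $ \<mu> $ \<kappa> * eps_up \<epsilon> $ \<mu> $ \<gamma>) * twist \<epsilon> \<gamma> \<alpha>)
      = (\<^bold>\<Sum>\<mu> \<nu>. \<epsilon> $ \<mu> $ \<kappa> * (\<^bold>\<Sum>\<gamma>. eps_up \<epsilon> $ \<mu> $ \<gamma> * \<epsilon> $ \<gamma> $ \<nu>) * eps_up \<epsilon> $ \<alpha> $ \<nu>)"
    by (simp add: twist_def sum_2 algebra_simps)
  also have "\<dots> = (\<^bold>\<Sum>\<mu>. \<epsilon> $ \<mu> $ \<kappa> * eps_up \<epsilon> $ \<alpha> $ \<mu>)"
    unfolding eps_up_eps mult.assoc sum_distrib_left[symmetric] sum_of_bool ..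
  also have "\<dots> = of_bool (\<kappa> = \<alpha>)"
    using eps_up_eps[of \<alpha> \<kappa>] by (simp add: mult.commute eq_commute)
  finally show ?thesis .
qed

lemma Rmat_ud_eq:
  "Rmat_ud \<epsilon> a s \<gamma> \<delta> \<tau> \<alpha> = complex_of_real (pm_power (sqrt a) (flip s)) *
     (\<epsilon> $ \<delta> $ \<alpha> * eps_up \<epsilon> $ \<gamma> $ \<tau> + complex_of_real (pm_power a s)
       * twist \<epsilon> \<delta> \<gamma> * (\<^bold>\<Sum>\<nu>. \<epsilon> $ \<nu> $ \<alpha> * eps_up \<epsilon> $ \<nu> $ \<tau>))"
proof -
  have "(\<^bold>\<Sum>\<kappa> \<nu>. \<epsilon> $ \<delta> $ \<kappa> * Rmat \<epsilon> a s \<gamma> \<kappa> \<nu> \<alpha> * eps_up \<epsilon> $ \<nu> $ \<tau>)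
    = (\<^bold>\<Sum>\<nu>. of_bool (\<gamma> = \<nu>) * (\<^bold>\<Sum>\<kappa>. \<epsilon> $ \<delta> $ \<kappa> * of_bool (\<kappa> = \<alpha>)) * eps_up \<epsilon> $ \<nu> $ \<tau>)
      + complex_of_real (pm_power a s)
       * twist \<epsilon> \<delta> \<gamma> * (\<^bold>\<Sum>\<nu>. \<epsilon> $ \<nu> $ \<alpha> * eps_up \<epsilon> $ \<nu> $ \<tau>)"
    by (simp add: Rmat_def twist_def sum_2 algebra_simps)
  also have "(\<^bold>\<Sum>\<nu>. of_bool (\<gamma> = \<nu>) * (\<^bold>\<Sum>\<kappa>. \<epsilon> $ \<delta> $ \<kappa> * of_bool (\<kappa> = \<alpha>)) * eps_up \<epsilon> $ \<nu> $ \<tau>)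
     = \<epsilon> $ \<delta> $ \<alpha> * eps_up \<epsilon> $ \<gamma> $ \<tau>"
    by (simp only: sum_of_bool mult.assoc)
  finally show ?thesis unfolding Rmat_ud_def by (simp only:)
qed

lemma flip_flip [simp]: "flip (flip s) = s"
  by (cases s) simp_all

text \<open>The contractions of \<open>\<epsilon>\<close> with its inverse turn the first summand of the R matrix into \<open>\<sigma>\<close> itself
  and the second one, which has rank one, into a multiple of the identity.\<close>

lemma pauli_bar_eq:
  "pauli_bar \<epsilon> a \<sigma> s J \<beta> \<gamma> = - complex_of_real (pm_power (sqrt a) s) *
     (\<sigma> J $ \<beta> $ \<gamma> + complex_of_real (pm_power a (flip s))
        * (\<^bold>\<Sum>\<tau> \<rho>. twist \<epsilon> \<rho> \<tau> * \<sigma> J $ \<tau> $ \<rho>) * of_bool (\<beta> = \<gamma>))"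
proof -
  let ?c = "complex_of_real (pm_power (sqrt a) s)" and ?d = "complex_of_real (pm_power a (flip s))"
  let ?t = "\<^bold>\<Sum>\<tau> \<rho>. twist \<epsilon> \<rho> \<tau> * \<sigma> J $ \<tau> $ \<rho>"
  have "pauli_bar \<epsilon> a \<sigma> s J \<beta> \<gamma> = - ?c *
     ((\<^bold>\<Sum>\<tau> \<rho>. (\<^bold>\<Sum>\<kappa>. eps_up \<epsilon> $ \<tau> $ \<kappa> * \<epsilon> $ \<kappa> $ \<beta>) * (\<^bold>\<Sum>\<nu>. \<epsilon> $ \<rho> $ \<nu> * eps_up \<epsilon> $ \<nu> $ \<gamma>) * \<sigma> J $ \<tau> $ \<rho>)
      + ?d * ?t * (\<^bold>\<Sum>\<mu>. (\<^bold>\<Sum>\<kappa>. eps_up \<epsilon> $ \<mu> $ \<kappa> * \<epsilon> $ \<kappa> $ \<beta>) * (\<^bold>\<Sum>\<nu>. \<epsilon> $ \<mu> $ \<nu> * eps_up \<epsilon> $ \<nu> $ \<gamma>)))"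
    unfolding pauli_bar_def Rmat_ud_eq eps_dot_up_eq flip_flip
    by (simp only: sum_2) (simp only: distrib_left distrib_right minus_mult_left[symmetric]
       minus_mult_right[symmetric] minus_add_distrib minus_minus mult.assoc mult.commute mult.left_commute add.assoc add.commute add.left_commute)
  also have "\<dots> = - ?c * (\<sigma> J $ \<beta> $ \<gamma> + ?d * ?t * of_bool (\<beta> = \<gamma>))"
    unfolding eps_eps_up eps_up_eps by (simp only: sum_of_bool mult.assoc sum_distrib_left[symmetric])
  finally show ?thesis .
qed

text \<open>If \<open>b(Y, _)\<close> vanishes then \<open>T Y + c tr(T Y) T = 0\<close> with \<open>c = a\<^sup>-\<^sup>s\<close>, so \<open>Y\<close> is the scalar
  \<open>- c tr(T Y)\<close>. Taking the trace with \<open>T\<close> gives \<open>tr(T Y) = c Q tr(T Y)\<close>, and \<open>c Q = 1 + c\<^sup>2\<close> is not 1.\<close>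

lemma spinor_form_nondegenerate:
  assumes y: "\<And>q. (\<^bold>\<Sum>p. spinor_form \<epsilon> a s p q * y p) = 0"
  shows "y p = 0"
proof -
  let ?c = "complex_of_real (pm_power a (flip s))"
  let ?T' = "\<lambda>\<kappa> \<gamma>. \<^bold>\<Sum>\<mu>. \<epsilon> $ \<mu> $ \<kappa> * eps_up \<epsilon> $ \<mu> $ \<gamma>"
  define t where "t = (\<^bold>\<Sum>p. twist \<epsilon> (snd p) (fst p) * y p)"
  have Ty: "(\<^bold>\<Sum>\<alpha>. twist \<epsilon> \<gamma> \<alpha> * y (\<alpha>, \<delta>)) = - ?c * t * twist \<epsilon> \<gamma> \<delta>" for \<gamma> \<delta>
  proof -
    have "(\<^bold>\<Sum>p. spinor_form \<epsilon> a s p (\<delta>, \<gamma>) * y p)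
      = form_scale a s * ((\<^bold>\<Sum>\<alpha> \<beta>. of_bool (\<beta> = \<delta>) * (twist \<epsilon> \<gamma> \<alpha> * y (\<alpha>, \<beta>))) + ?c * t * twist \<epsilon> \<gamma> \<delta>)"
      by (simp add: spinor_form_def t_def sum_pair sum_2 algebra_simps)
    then show ?thesis
      using y[of "(\<delta>, \<gamma>)"] form_scale_nonzero[of s]
      by (simp add: sum_of_bool eq_neg_iff_add_eq_0)
  qed
  have y_scalar: "y (\<kappa>, \<delta>) = - ?c * t * of_bool (\<kappa> = \<delta>)" for \<kappa> \<delta>
  proof -
    have "y (\<kappa>, \<delta>) = (\<^bold>\<Sum>\<alpha>. (\<^bold>\<Sum>\<gamma>. ?T' \<kappa> \<gamma> * twist \<epsilon> \<gamma> \<alpha>) * y (\<alpha>, \<delta>))"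
      unfolding twist_left_inverse sum_of_bool ..
    also have "\<dots> = (\<^bold>\<Sum>\<gamma>. ?T' \<kappa> \<gamma> * (\<^bold>\<Sum>\<alpha>. twist \<epsilon> \<gamma> \<alpha> * y (\<alpha>, \<delta>)))"
      by (simp add: sum_2 algebra_simps)
    also have "\<dots> = - ?c * t * (\<^bold>\<Sum>\<gamma>. ?T' \<kappa> \<gamma> * twist \<epsilon> \<gamma> \<delta>)"
      unfolding Ty by (simp add: sum_2 algebra_simps)
    finally show ?thesis unfolding twist_left_inverse .
  qed
  have "t = (\<^bold>\<Sum>\<alpha> \<beta>. twist \<epsilon> \<beta> \<alpha> * (- ?c * t * of_bool (\<alpha> = \<beta>)))"
    unfolding y_scalar[symmetric] by (simp add: t_def sum_pair)
  also have "\<dots> = - ?c * t * (\<^bold>\<Sum>\<alpha> \<beta>. twist \<epsilon> \<beta> \<alpha> * of_bool (\<alpha> = \<beta>))"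
    by (simp add: sum_2 algebra_simps)
  also have "\<dots> = ?c * t * Qc a"
    by (simp add: sum_of_bool trace_twist)
  finally have "t = t * (?c * Qc a)" by (simp add: mult_ac)
  moreover have "?c * Qc a = 1 + ?c\<^sup>2"
    using a_nonzero by (cases s) (simp_all add: Qc_def power2_eq_square field_simps)
  ultimately have "t * ?c\<^sup>2 = 0"
    by (simp add: distrib_left)
  moreover have "?c \<noteq> 0" using a_nonzero by (cases s) simp_all
  ultimately have "t = 0" by simp
  then show ?thesis using y_scalar[of "fst p" "snd p"] by simp
qed

end

section \<open>The metric and the dual basis of the Pauli matrices\<close>

context quantum_pauli
begin

text \<open>Four linearly independent matrices span the four-dimensional space of matrices, so only zero
  is orthogonal to all of them.\<close>

lemma pauli_separating:
  assumes w: "\<And>J. (\<^bold>\<Sum>p. entry (\<sigma> J) p * w p) = 0"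
  shows "w p = 0"
proof -
  have "card (UNIV :: 4 set) = card (UNIV :: (2 \<times> 2) set)"
    by simp
  then obtain h :: "4 \<Rightarrow> 2 \<times> 2" where h: "bij_betw h UNIV UNIV"
    using finite_same_card_bij[OF finite finite] by blast
  define A :: "complex^4^4" where "A = (\<chi> I J. entry (\<sigma> I) (h J))"
  have "c = 0" if "transpose A *v c = 0" for c
  proof -
    have "(\<^bold>\<Sum>I. c $ I * entry (\<sigma> I) p) = 0" for p
    proof -
      obtain J where "p = h J" using h by (metis bij_betw_imp_surj surjD)
      then show ?thesis
        using that by (simp add: A_def transpose_def matrix_vector_mult_def vec_eq_iff mult.commute)
    qed
    note * = this
    have "c $ I = 0" for I
    proof (rule lin_indep[of "\<lambda>I. c $ I"])
      show "(\<^bold>\<Sum>J. c $ J * \<sigma> J $ \<alpha> $ \<beta>) = 0" for \<alpha> \<beta>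
        using *[of "(\<alpha>, \<beta>)"] by simp
    qed
    then show ?thesis by (simp add: vec_eq_iff)
  qed
  then have "invertible A"
    by (rule invertible_of_left_kernel)
  moreover have "A *v (\<chi> J. w (h J)) = 0"
  proof -
    have "(\<^bold>\<Sum>J. entry (\<sigma> I) (h J) * w (h J)) = 0" for I
      using w[of I] sum.reindex_bij_betw[OF h, of "\<lambda>p. entry (\<sigma> I) p * w p"] by simp
    then show ?thesis by (simp add: A_def matrix_vector_mult_def vec_eq_iff)
  qed
  ultimately have "(\<chi> J. w (h J)) = 0"
    by (metis invertible_def matrix_vector_mul_assoc matrix_vector_mul_lid matrix_vector_mult_0_right)
  then have "w (h J) = 0" for J by (simp add: vec_eq_iff)
  then show ?thesis using h by (metis bij_betw_imp_surj surjD)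
qed

end

locale spinor_pauli = spinor_metric \<epsilon> a + quantum_pauli \<sigma>
  for \<epsilon> :: "complex^2^2" and a :: real and \<sigma> :: "4 \<Rightarrow> complex^2^2"
begin

lemma spinor_form_pauli_right:
  "(\<^bold>\<Sum>q. spinor_form \<epsilon> a s p q * entry (\<sigma> J) q)
     = 1 / Qc a * (\<^bold>\<Sum>\<gamma>. pauli_bar \<epsilon> a \<sigma> s J (snd p) \<gamma> * twist \<epsilon> \<gamma> (fst p))"
proof -
  define b c d t where "b = snd p" and "c = complex_of_real (pm_power a (flip s))"
    and "d = complex_of_real (pm_power (sqrt a) s)"
    and "t = (\<^bold>\<Sum>\<tau> \<rho>. twist \<epsilon> \<rho> \<tau> * \<sigma> J $ \<tau> $ \<rho>)"
  have "(\<^bold>\<Sum>q. spinor_form \<epsilon> a s p q * entry (\<sigma> J) q) = form_scale a s *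
     ((\<^bold>\<Sum>\<gamma> \<delta>. of_bool (b = \<delta>) * (twist \<epsilon> \<gamma> (fst p) * \<sigma> J $ \<delta> $ \<gamma>)) + c * t * twist \<epsilon> b (fst p))"
    by (simp add: spinor_form_def sum_pair sum_2 algebra_simps flip: b_def c_def) (simp add: t_def sum_2 algebra_simps)
  also have "\<dots> = 1 / Qc a * (- d *
     ((\<^bold>\<Sum>\<gamma>. \<sigma> J $ b $ \<gamma> * twist \<epsilon> \<gamma> (fst p)) + c * t * (\<^bold>\<Sum>\<gamma>. of_bool (b = \<gamma>) * twist \<epsilon> \<gamma> (fst p))))"
    unfolding sum_of_bool by (simp add: form_scale_def d_def mult.commute)
  also have "- d * ((\<^bold>\<Sum>\<gamma>. \<sigma> J $ b $ \<gamma> * twist \<epsilon> \<gamma> (fst p)) + c * t * (\<^bold>\<Sum>\<gamma>. of_bool (b = \<gamma>) * twist \<epsilon> \<gamma> (fst p)))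
     = (\<^bold>\<Sum>\<gamma>. pauli_bar \<epsilon> a \<sigma> s J b \<gamma> * twist \<epsilon> \<gamma> (fst p))"
    unfolding pauli_bar_eq t_def[symmetric] c_def[symmetric] d_def[symmetric]
    by (simp only: sum_2 distrib_left distrib_right mult_ac add_ac)
  finally show ?thesis unfolding b_def .
qed

lemma spinor_form_pauli_left:
  "(\<^bold>\<Sum>p. spinor_form \<epsilon> a s p q * entry (\<sigma> I) p)
     = 1 / Qc a * (\<^bold>\<Sum>\<alpha>. twist \<epsilon> (snd q) \<alpha> * pauli_bar \<epsilon> a \<sigma> s I \<alpha> (fst q))"
proof -
  define b c d t where "b = fst q" and "c = complex_of_real (pm_power a (flip s))"
    and "d = complex_of_real (pm_power (sqrt a) s)"
    and "t = (\<^bold>\<Sum>\<tau> \<rho>. twist \<epsilon> \<rho> \<tau> * \<sigma> I $ \<tau> $ \<rho>)"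
  have "(\<^bold>\<Sum>p. spinor_form \<epsilon> a s p q * entry (\<sigma> I) p) = form_scale a s *
     ((\<^bold>\<Sum>\<alpha> \<beta>. of_bool (\<beta> = b) * (twist \<epsilon> (snd q) \<alpha> * \<sigma> I $ \<alpha> $ \<beta>)) + c * t * twist \<epsilon> (snd q) b)"
    by (simp add: spinor_form_def sum_pair sum_2 algebra_simps flip: b_def c_def) (simp add: t_def sum_2 algebra_simps)
  also have "\<dots> = 1 / Qc a * (- d *
     ((\<^bold>\<Sum>\<alpha>. twist \<epsilon> (snd q) \<alpha> * \<sigma> I $ \<alpha> $ b) + c * t * (\<^bold>\<Sum>\<alpha>. twist \<epsilon> (snd q) \<alpha> * of_bool (\<alpha> = b))))"
    unfolding sum_of_bool by (simp add: form_scale_def d_def mult.commute)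
  also have "- d * ((\<^bold>\<Sum>\<alpha>. twist \<epsilon> (snd q) \<alpha> * \<sigma> I $ \<alpha> $ b) + c * t * (\<^bold>\<Sum>\<alpha>. twist \<epsilon> (snd q) \<alpha> * of_bool (\<alpha> = b)))
     = (\<^bold>\<Sum>\<alpha>. twist \<epsilon> (snd q) \<alpha> * pauli_bar \<epsilon> a \<sigma> s I \<alpha> b)"
    unfolding pauli_bar_eq t_def[symmetric] c_def[symmetric] d_def[symmetric]
    by (simp only: sum_2 distrib_left distrib_right mult_ac add_ac)
  finally show ?thesis unfolding b_def .
qed

text \<open>The metric is the Gram matrix of the form in the basis of Pauli matrices. Attaching the bar to the
  second or to the first Pauli matrix corresponds to the two defining expressions of the metric.\<close>

lemma metric_up_eq_right:
  "metric_up \<epsilon> a \<sigma> s $ I $ J = (\<^bold>\<Sum>p. entry (\<sigma> I) p * (\<^bold>\<Sum>q. spinor_form \<epsilon> a s p q * entry (\<sigma> J) q))"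
  unfolding spinor_form_pauli_right
  by (simp add: metric_up_def sum_pair twist_def sum_2 algebra_simps)

lemma metric_up_eq_left:
  "metric_up \<epsilon> a \<sigma> s $ I $ J = (\<^bold>\<Sum>q. (\<^bold>\<Sum>p. spinor_form \<epsilon> a s p q * entry (\<sigma> I) p) * entry (\<sigma> J) q)"
  unfolding metric_up_eq_right sum_distrib_left sum_distrib_right
  by (subst sum.swap) (simp add: mult_ac)

lemma metric_inverse:
  "(\<^bold>\<Sum>J. metric_up \<epsilon> a \<sigma> s $ I $ J * metric_low \<epsilon> a \<sigma> s $ J $ K) = of_bool (I = K)"
  "(\<^bold>\<Sum>J. metric_low \<epsilon> a \<sigma> s $ I $ J * metric_up \<epsilon> a \<sigma> s $ J $ K) = of_bool (I = K)"
proof -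
  let ?G = "metric_up \<epsilon> a \<sigma> s"
  have "v = 0" if v: "transpose ?G *v v = 0" for v
  proof -
    define y where "y p = (\<^bold>\<Sum>I. v $ I * entry (\<sigma> I) p)" for p
    have "(\<^bold>\<Sum>q. entry (\<sigma> J) q * (\<^bold>\<Sum>p. spinor_form \<epsilon> a s p q * y p)) = 0" for J
    proof -
      have "(\<^bold>\<Sum>q. entry (\<sigma> J) q * (\<^bold>\<Sum>p. spinor_form \<epsilon> a s p q * y p))
         = (\<^bold>\<Sum>q I. v $ I * ((\<^bold>\<Sum>p. spinor_form \<epsilon> a s p q * entry (\<sigma> I) p) * entry (\<sigma> J) q))"
        unfolding y_def sum_distrib_left sum_distrib_right
        by (rule sum.cong[OF HOL.refl], subst sum.swap) (simp add: mult_ac)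
      also have "\<dots> = (\<^bold>\<Sum>I. v $ I * ?G $ I $ J)"
        unfolding metric_up_eq_left sum_distrib_left[of "v $ _"] by (rule sum.swap)
      also have "\<dots> = (transpose ?G *v v) $ J"
        by (simp add: matrix_vector_mult_def transpose_def mult.commute)
      finally show ?thesis using v by simp
    qed
    then have "(\<^bold>\<Sum>p. spinor_form \<epsilon> a s p q * y p) = 0" for q
      by (rule pauli_separating)
    then have "y p = 0" for p
      by (rule spinor_form_nondegenerate)
    note y0 = this
    have "v $ I = 0" for I
    proof (rule lin_indep[of "\<lambda>I. v $ I"])
      show "(\<^bold>\<Sum>J. v $ J * \<sigma> J $ \<alpha> $ \<beta>) = 0" for \<alpha> \<beta>
        using y0[of "(\<alpha>, \<beta>)"] by (simp add: y_def)
    qed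
    then show "v = 0" by (simp add: vec_eq_iff)
  qed
  then have "invertible ?G"
    by (rule invertible_of_left_kernel)
  from matrix_inv_inverse[OF this] have "?G ** metric_low \<epsilon> a \<sigma> s = mat 1" "metric_low \<epsilon> a \<sigma> s ** ?G = mat 1"
    by (simp_all add: metric_low_def)
  then show "(\<^bold>\<Sum>J. metric_up \<epsilon> a \<sigma> s $ I $ J * metric_low \<epsilon> a \<sigma> s $ J $ K) = of_bool (I = K)"
    "(\<^bold>\<Sum>J. metric_low \<epsilon> a \<sigma> s $ I $ J * metric_up \<epsilon> a \<sigma> s $ J $ K) = of_bool (I = K)"
    by (simp_all add: matrix_matrix_mult_def mat_def vec_eq_iff)
qed

text \<open>The entry at \<open>p\<close> is the transposed entry of \<open>T\<close> times the barred Pauli matrix, so that the trace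
  pairing becomes a plain sum over \<open>p\<close>.\<close>

definition pauli_dual :: "pm \<Rightarrow> 4 \<Rightarrow> 2 \<times> 2 \<Rightarrow> complex" where
  "pauli_dual s L p = 1 / Qc a * (\<^bold>\<Sum>\<alpha>. twist \<epsilon> (snd p) \<alpha> * pauli_bar_low \<epsilon> a \<sigma> s L \<alpha> (fst p))"

lemma pauli_dual_eq:
  "pauli_dual s L q = (\<^bold>\<Sum>I. metric_low \<epsilon> a \<sigma> s $ L $ I * (\<^bold>\<Sum>p. spinor_form \<epsilon> a s p q * entry (\<sigma> I) p))"
  unfolding spinor_form_pauli_left pauli_dual_def pauli_bar_low_def sum_distrib_left
  by (subst sum.swap) (simp add: mult_ac)

lemma pauli_dual_pauli: "(\<^bold>\<Sum>p. pauli_dual s L p * entry (\<sigma> K) p) = of_bool (L = K)"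
proof -
  have "(\<^bold>\<Sum>p. pauli_dual s L p * entry (\<sigma> K) p)
      = (\<^bold>\<Sum>I. metric_low \<epsilon> a \<sigma> s $ L $ I * metric_up \<epsilon> a \<sigma> s $ I $ K)"
    unfolding pauli_dual_eq metric_up_eq_left sum_distrib_left[of "metric_low _ _ _ _ $ _ $ _"]
      sum_distrib_right[of _ _ "entry (\<sigma> K) _"]
    by (subst sum.swap) (simp add: mult_ac)
  then show ?thesis by (simp add: metric_inverse)
qed

text \<open>Completeness follows from duality because a defect would be orthogonal to all Pauli matrices.\<close>

lemma pauli_pauli_dual: "(\<^bold>\<Sum>L. entry (\<sigma> L) p * pauli_dual s L q) = of_bool (p = q)"
proof -
  let ?w = "\<lambda>q. (\<^bold>\<Sum>L. entry (\<sigma> L) p * pauli_dual s L q) - of_bool (p = q)"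
  have "(\<^bold>\<Sum>q. entry (\<sigma> J) q * ?w q) = 0" for J
  proof -
    have "(\<^bold>\<Sum>q. entry (\<sigma> J) q * ?w q)
        = (\<^bold>\<Sum>q L. entry (\<sigma> L) p * (pauli_dual s L q * entry (\<sigma> J) q)) - entry (\<sigma> J) p"
      by (simp add: right_diff_distrib sum_subtractf sum_of_bool sum_distrib_left mult_ac)
    also have "(\<^bold>\<Sum>q L. entry (\<sigma> L) p * (pauli_dual s L q * entry (\<sigma> J) q))
        = (\<^bold>\<Sum>L. entry (\<sigma> L) p * of_bool (L = J))"
      by (subst sum.swap) (simp flip: sum_distrib_left add: pauli_dual_pauli)
    finally show ?thesis by (simp add: sum_of_bool)
  qed
  then have "?w q = 0" by (rule pauli_separating)
  then show ?thesis by simp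
qed

end

section \<open>The antipode of quantum SL(2,C)\<close>

lemma star_sum: "star (\<Sum>i\<in>I. f i) = (\<Sum>i\<in>I. star (f i :: 'a::complex_star_algebra_1))"
  by (rule additive.sum) (simp add: Modules.additive_def star_add)

lemma star_one [simp]: "star (1 :: 'a::complex_star_algebra_1) = 1"
  using star_mult[of "star (1 :: 'a)" 1] by (simp add: star_star)

lemmas scaleC_sum_left = complex_vector.scale_sum_left
lemmas scaleC_sum_right = complex_vector.scale_sum_right

lemma sum_of_bool_scaleC:
  fixes f :: "'i::finite \<Rightarrow> 'a::complex_vector"
  shows "(\<Sum>i\<in>UNIV. of_bool (i = j) *\<^sub>C f i) = f j" "(\<Sum>i\<in>UNIV. of_bool (j = i) *\<^sub>C f i) = f j"
  by (simp_all add: of_bool_def if_distrib if_distribR scaleC_one cong: if_cong)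

context quantum_SL2C
begin

lemma corep_M: "corep UNIV (\<lambda>\<alpha> \<beta>. M $ \<alpha> $ \<beta>)"
  by (simp add: corep_def comult_M counit_M)

lemma corep_dotted_M: "corep UNIV (\<lambda>\<alpha> \<beta>. dotted M $ \<alpha> $ \<beta>)"
  by (simp add: corep_def comult_dotted_M counit_dotted_M)

lemma S_mult: "S (x * y) = S y * S x"
proof (rule antipode_mult[OF _ generated])
  show "{M $ \<alpha> $ \<beta> | \<alpha> \<beta>. True} \<union> {dotted M $ \<alpha> $ \<beta> | \<alpha> \<beta>. True} \<subseteq> corep_coeffs"
    using corep_coeffsI[OF corep_M] corep_coeffsI[OF corep_dotted_M] by auto
qed simp_all

lemma S_one: "S 1 = 1"
  using corep_antipode(1)[OF corep_one] by simp

lemma star_dotted: "star (dotted M $ \<alpha> $ \<beta>) = M $ \<alpha> $ \<beta>"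
  by (simp add: dotted_def star_star)

lemma star_M: "star (M $ \<alpha> $ \<beta>) = dotted M $ \<alpha> $ \<beta>"
  by (simp add: dotted_def)

lemma cnj_eps: "cnj (\<epsilon> $ \<alpha> $ \<beta>) = - eps_up \<epsilon> $ \<alpha> $ \<beta>"
  and cnj_eps_up: "cnj (eps_up \<epsilon> $ \<alpha> $ \<beta>) = - \<epsilon> $ \<alpha> $ \<beta>"
  using eps_dot_eq[of \<beta> \<alpha>] eps_dot_up_eq[of \<beta> \<alpha>] by (simp_all add: eps_dot_def eps_dot_up_def)

lemma S_inverse_dotted_M:
  "S (\<^bold>\<Sum>\<delta> \<kappa>. (\<epsilon> $ \<delta> $ \<gamma> * eps_up \<epsilon> $ \<rho> $ \<kappa>) *\<^sub>C dotted M $ \<delta> $ \<kappa>) = dotted M $ \<rho> $ \<gamma>"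
proof -
  have "S (\<^bold>\<Sum>\<delta> \<kappa>. (\<epsilon> $ \<delta> $ \<gamma> * eps_up \<epsilon> $ \<rho> $ \<kappa>) *\<^sub>C dotted M $ \<delta> $ \<kappa>)
    = (\<^bold>\<Sum>\<delta> \<kappa> \<mu> \<nu>. (\<epsilon> $ \<delta> $ \<gamma> * eps_up \<epsilon> $ \<rho> $ \<kappa> * (eps_up \<epsilon> $ \<mu> $ \<delta> * \<epsilon> $ \<kappa> $ \<nu>))
        *\<^sub>C dotted M $ \<nu> $ \<mu>)"
    by (simp only: antipode_sum antipode_scaleC antipode_dotted_M eps_dot_eq eps_dot_up_eq scaleC_sum_right
        scaleC_scaleC minus_mult_minus)
  also have "\<dots> = (\<^bold>\<Sum>\<mu> \<nu>. ((\<^bold>\<Sum>\<delta>. eps_up \<epsilon> $ \<mu> $ \<delta> * \<epsilon> $ \<delta> $ \<gamma>) * (\<^bold>\<Sum>\<kappa>. eps_up \<epsilon> $ \<rho> $ \<kappa> * \<epsilon> $ \<kappa> $ \<nu>))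
      *\<^sub>C dotted M $ \<nu> $ \<mu>)"
    by (simp only: sum_2 scaleC_add_left distrib_left distrib_right mult_ac add_ac)
  also have "\<dots> = dotted M $ \<rho> $ \<gamma>"
    unfolding eps_up_eps by (simp only: scaleC_scaleC[symmetric] scaleC_sum_right[symmetric] sum_of_bool_scaleC)
  finally show ?thesis .
qed

lemma S_inverse_M:
  "S (\<^bold>\<Sum>\<delta> \<kappa>. (eps_up \<epsilon> $ \<gamma> $ \<delta> * \<epsilon> $ \<kappa> $ \<rho>) *\<^sub>C M $ \<delta> $ \<kappa>) = M $ \<rho> $ \<gamma>"
proof -
  have "S (\<^bold>\<Sum>\<delta> \<kappa>. (eps_up \<epsilon> $ \<gamma> $ \<delta> * \<epsilon> $ \<kappa> $ \<rho>) *\<^sub>C M $ \<delta> $ \<kappa>)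
    = (\<^bold>\<Sum>\<delta> \<kappa> \<mu> \<nu>. (eps_up \<epsilon> $ \<gamma> $ \<delta> * \<epsilon> $ \<kappa> $ \<rho> * (\<epsilon> $ \<delta> $ \<mu> * eps_up \<epsilon> $ \<nu> $ \<kappa>))
        *\<^sub>C M $ \<nu> $ \<mu>)"
    by (simp add: antipode_sum antipode_scaleC antipode_M scaleC_sum_right scaleC_scaleC)
  also have "\<dots> = (\<^bold>\<Sum>\<mu> \<nu>. ((\<^bold>\<Sum>\<delta>. eps_up \<epsilon> $ \<gamma> $ \<delta> * \<epsilon> $ \<delta> $ \<mu>) * (\<^bold>\<Sum>\<kappa>. eps_up \<epsilon> $ \<nu> $ \<kappa> * \<epsilon> $ \<kappa> $ \<rho>))
      *\<^sub>C M $ \<nu> $ \<mu>)"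
    by (simp only: sum_2 scaleC_add_left distrib_left distrib_right mult_ac add_ac)
  also have "\<dots> = M $ \<rho> $ \<gamma>"
    unfolding eps_up_eps by (simp only: scaleC_scaleC[symmetric] scaleC_sum_right[symmetric] sum_of_bool_scaleC)
  finally show ?thesis .
qed

text \<open>Both sides are antimultiplicative in \<open>x\<close> and antilinear, so generators suffice; there it is the
  computation of the inverse antipode.\<close>

lemma S_star_S: "S (star (S x)) = star x"
proof -
  let ?B = "{x. S (star (S x)) = star x}"
  have "S (star (S (M $ \<alpha> $ \<beta>))) = star (M $ \<alpha> $ \<beta>)" for \<alpha> \<beta>
  proof -
    have "star (S (M $ \<alpha> $ \<beta>))
        = (\<^bold>\<Sum>\<delta> \<gamma>. (\<epsilon> $ \<delta> $ \<beta> * eps_up \<epsilon> $ \<alpha> $ \<gamma>) *\<^sub>C dotted M $ \<delta> $ \<gamma>)"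
      unfolding antipode_M by (subst sum.swap) (simp add: star_sum star_scaleC star_M cnj_eps cnj_eps_up mult.commute)
    then show ?thesis by (simp only: S_inverse_dotted_M star_M)
  qed
  moreover have "S (star (S (dotted M $ \<alpha> $ \<beta>))) = star (dotted M $ \<alpha> $ \<beta>)" for \<alpha> \<beta>
  proof -
    have "star (S (dotted M $ \<alpha> $ \<beta>))
        = (\<^bold>\<Sum>\<delta> \<gamma>. (eps_up \<epsilon> $ \<beta> $ \<delta> * \<epsilon> $ \<gamma> $ \<alpha>) *\<^sub>C M $ \<delta> $ \<gamma>)"
      unfolding antipode_dotted_M
      by (subst sum.swap) (simp add: star_sum star_scaleC star_dotted eps_dot_eq eps_dot_up_eq cnj_eps cnj_eps_up mult.commute)
    then show ?thesis by (simp only: S_inverse_M star_dotted)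
  qed
  moreover have "unital_subalgebra ?B"
    by (simp add: unital_subalgebra_def S_one S_mult star_mult star_add star_scaleC antipode_add antipode_scaleC)
  ultimately have "unital_subalgebra hull
      ({M $ \<alpha> $ \<beta> | \<alpha> \<beta>. True} \<union> {dotted M $ \<alpha> $ \<beta> | \<alpha> \<beta>. True}) \<subseteq> ?B"
    by (intro hull_minimal) auto
  then show ?thesis unfolding generated by blast
qed

lemma inj_S: "inj S"
  by (rule injI) (metis S_star_S star_star)

lemma inv_S_dotted_M:
  "inv S (dotted M $ \<rho> $ \<gamma>) = (\<^bold>\<Sum>\<delta> \<kappa>. (\<epsilon> $ \<delta> $ \<gamma> * eps_up \<epsilon> $ \<rho> $ \<kappa>) *\<^sub>C dotted M $ \<delta> $ \<kappa>)"
  by (rule inv_f_eq[OF inj_S S_inverse_dotted_M])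

section \<open>The vector corepresentation and its invariant form\<close>

text \<open>The matrix of \<open>X \<mapsto> M X M\<^sup>*\<close> on matrix units.\<close>

definition vector_rep :: "2 \<times> 2 \<Rightarrow> 2 \<times> 2 \<Rightarrow> 'a" where
  "vector_rep p q = M $ fst p $ fst q * dotted M $ snd p $ snd q"

lemma corep_vector_rep: "corep UNIV vector_rep"
  using corep_product[OF corep_M corep_dotted_M] by (simp add: vector_rep_def[abs_def])

lemma Rmat_M_dotted_M:
  "(\<^bold>\<Sum>\<gamma> \<delta>. Rmat \<epsilon> a s \<beta> \<delta> \<rho> \<gamma> *\<^sub>C (M $ \<alpha> $ \<gamma> * dotted M $ \<tau> $ \<delta>))
     = (\<^bold>\<Sum>\<delta> \<gamma>. Rmat \<epsilon> a s \<gamma> \<tau> \<delta> \<alpha> *\<^sub>C (dotted M $ \<delta> $ \<rho> * M $ \<gamma> $ \<beta>))"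
proof -
  let ?k = "complex_of_real (pm_power (sqrt a) (flip s))"
  have "?k *\<^sub>C (\<^bold>\<Sum>\<gamma> \<delta>. Rmat \<epsilon> a s \<beta> \<delta> \<rho> \<gamma> *\<^sub>C (M $ \<alpha> $ \<gamma> * dotted M $ \<tau> $ \<delta>))
     = ?k *\<^sub>C (\<^bold>\<Sum>\<delta> \<gamma>. Rmat \<epsilon> a s \<gamma> \<tau> \<delta> \<alpha> *\<^sub>C (dotted M $ \<delta> $ \<rho> * M $ \<gamma> $ \<beta>))"
    using M_dotted_M[of "flip s" \<rho> \<beta> \<alpha> \<tau>] by (simp add: Rmat_du_def scaleC_sum_right scaleC_scaleC)
  moreover have "?k \<noteq> 0" using a_nonzero by (cases s) simp_all
  ultimately show ?thesis by simp
qed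

text \<open>This shape of the coefficients is what survives the exchange of factors below: the two metrics
  act on the outer indices, the R matrix on the middle ones.\<close>

lemma spinor_form_Rmat:
  "spinor_form \<epsilon> a s (\<alpha>, \<beta>) (\<delta>, \<gamma>) = form_scale a s *
    (\<^bold>\<Sum>\<kappa> \<tau>. eps_up \<epsilon> $ \<alpha> $ \<kappa> * \<epsilon> $ \<gamma> $ \<tau> * Rmat \<epsilon> a (flip s) \<delta> \<tau> \<beta> \<kappa>)"
proof -
  have "(\<^bold>\<Sum>\<kappa> \<tau>. eps_up \<epsilon> $ \<alpha> $ \<kappa> * \<epsilon> $ \<gamma> $ \<tau> * Rmat \<epsilon> a (flip s) \<delta> \<tau> \<beta> \<kappa>)
    = (\<^bold>\<Sum>\<kappa> \<tau>. of_bool (\<tau> = \<kappa>) * (eps_up \<epsilon> $ \<alpha> $ \<kappa> * \<epsilon> $ \<gamma> $ \<tau>)) * of_bool (\<delta> = \<beta>)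
     + complex_of_real (pm_power a (flip s)) * ((\<^bold>\<Sum>\<kappa>. \<epsilon> $ \<beta> $ \<kappa> * eps_up \<epsilon> $ \<alpha> $ \<kappa>)
        * (\<^bold>\<Sum>\<tau>. \<epsilon> $ \<gamma> $ \<tau> * eps_up \<epsilon> $ \<delta> $ \<tau>))"
    unfolding sum_product Rmat_def
    by (simp only: distrib_left sum.distrib sum_distrib_left sum_distrib_right mult_ac)
  moreover have "(\<delta> = \<beta>) = (\<beta> = \<delta>)" by (rule eq_commute)
  ultimately show ?thesis
    unfolding sum_of_bool spinor_form_def twist_def by (simp only: fst_conv snd_conv mult_ac)
qed

text \<open>In \<open>M X M\<^sup>* M Y M\<^sup>*\<close> the middle product is of a dotted and an undotted generator. Exchanging them
  with the R matrix brings the two undotted generators together on the left and the two dotted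
  ones on the right, where the metrics contract them to numbers.\<close>

lemma vector_rep_invariant:
  "(\<^bold>\<Sum>p q. spinor_form \<epsilon> a s p q *\<^sub>C (vector_rep p p' * vector_rep q q')) = spinor_form \<epsilon> a s p' q' *\<^sub>C 1"
proof -
  obtain \<tau> \<rho> \<kappa> \<eta> where p': "p' = (\<tau>, \<rho>)" and q': "q' = (\<kappa>, \<eta>)" by (metis surj_pair)
  let ?R = "Rmat \<epsilon> a (flip s)"
  \<comment> \<open>As rewrite rules these permutations of summations would loop, so they are applied by transitivity.\<close>
  have swap: "(\<^bold>\<Sum>\<alpha> \<beta> \<delta> \<gamma> \<mu> \<nu>. F \<alpha> \<beta> \<delta> \<gamma> \<mu> \<nu>) = (\<^bold>\<Sum>\<alpha> \<gamma> \<mu> \<nu> \<beta> \<delta>. F \<alpha> \<beta> \<delta> \<gamma> \<mu> \<nu>)"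
    for F :: "2 \<Rightarrow> 2 \<Rightarrow> 2 \<Rightarrow> 2 \<Rightarrow> 2 \<Rightarrow> 2 \<Rightarrow> 'a"
    unfolding sum.cartesian_product UNIV_Times_UNIV
    by (rule sum.reindex_bij_witness[of _ "\<lambda>(\<alpha>, \<gamma>, \<mu>, \<nu>, \<beta>, \<delta>). (\<alpha>, \<beta>, \<delta>, \<gamma>, \<mu>, \<nu>)" "\<lambda>(\<alpha>, \<beta>, \<delta>, \<gamma>, \<mu>, \<nu>). (\<alpha>, \<gamma>, \<mu>, \<nu>, \<beta>, \<delta>)"]) auto
  have swap': "(\<^bold>\<Sum>\<alpha> \<gamma> \<mu> \<nu> \<beta> \<delta>. F \<alpha> \<gamma> \<mu> \<nu> \<beta> \<delta>) = (\<^bold>\<Sum>\<beta> \<delta> \<alpha> \<mu> \<nu> \<gamma>. F \<alpha> \<gamma> \<mu> \<nu> \<beta> \<delta>)"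
    for F :: "2 \<Rightarrow> 2 \<Rightarrow> 2 \<Rightarrow> 2 \<Rightarrow> 2 \<Rightarrow> 2 \<Rightarrow> 'a"
    unfolding sum.cartesian_product UNIV_Times_UNIV
    by (rule sum.reindex_bij_witness[of _ "\<lambda>(\<beta>, \<delta>, \<alpha>, \<mu>, \<nu>, \<gamma>). (\<alpha>, \<gamma>, \<mu>, \<nu>, \<beta>, \<delta>)" "\<lambda>(\<alpha>, \<gamma>, \<mu>, \<nu>, \<beta>, \<delta>). (\<beta>, \<delta>, \<alpha>, \<mu>, \<nu>, \<gamma>)"]) auto
  have U: "(\<^bold>\<Sum>\<alpha> \<mu>. eps_up \<epsilon> $ \<alpha> $ \<mu> *\<^sub>C (M $ \<alpha> $ \<tau> * M $ \<mu> $ \<beta>)) = eps_up \<epsilon> $ \<tau> $ \<beta> *\<^sub>C 1" for \<beta>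
    by (rule eps_up_M_M)
  have E: "(\<^bold>\<Sum>\<nu> \<gamma>. \<epsilon> $ \<gamma> $ \<nu> *\<^sub>C (dotted M $ \<nu> $ \<delta> * dotted M $ \<gamma> $ \<eta>)) = \<epsilon> $ \<eta> $ \<delta> *\<^sub>C 1" for \<delta>
    using eps_dot_up_M_M[of \<delta> \<eta>] by (simp add: eps_dot_up_eq sum_negf)
  have "(\<^bold>\<Sum>p q. spinor_form \<epsilon> a s p q *\<^sub>C (vector_rep p p' * vector_rep q q'))
    = form_scale a s *\<^sub>C (\<^bold>\<Sum>\<alpha> \<gamma> \<mu> \<nu>. (eps_up \<epsilon> $ \<alpha> $ \<mu> * \<epsilon> $ \<gamma> $ \<nu>) *\<^sub>C
       (M $ \<alpha> $ \<tau> * (\<^bold>\<Sum>\<beta> \<delta>. ?R \<delta> \<nu> \<beta> \<mu> *\<^sub>C (dotted M $ \<beta> $ \<rho> * M $ \<delta> $ \<kappa>)) * dotted M $ \<gamma> $ \<eta>))"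
    unfolding sum_pair spinor_form_Rmat p' q' vector_rep_def fst_conv snd_conv scaleC_sum_left sum_distrib_left
      sum_distrib_right
    by (rule HOL.trans[OF swap])
      (simp only: scaleC_sum_right scaleC_scaleC mult_scaleC_left mult_scaleC_right mult.assoc)
  also have "\<dots> = form_scale a s *\<^sub>C (\<^bold>\<Sum>\<alpha> \<gamma> \<mu> \<nu>. (eps_up \<epsilon> $ \<alpha> $ \<mu> * \<epsilon> $ \<gamma> $ \<nu>) *\<^sub>C
       (M $ \<alpha> $ \<tau> * (\<^bold>\<Sum>\<beta> \<delta>. ?R \<kappa> \<delta> \<rho> \<beta> *\<^sub>C (M $ \<mu> $ \<beta> * dotted M $ \<nu> $ \<delta>)) * dotted M $ \<gamma> $ \<eta>))"
    unfolding Rmat_M_dotted_M ..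
  also have "\<dots> = form_scale a s *\<^sub>C (\<^bold>\<Sum>\<beta> \<delta>. ?R \<kappa> \<delta> \<rho> \<beta> *\<^sub>C
      ((\<^bold>\<Sum>\<alpha> \<mu>. eps_up \<epsilon> $ \<alpha> $ \<mu> *\<^sub>C (M $ \<alpha> $ \<tau> * M $ \<mu> $ \<beta>))
       * (\<^bold>\<Sum>\<nu> \<gamma>. \<epsilon> $ \<gamma> $ \<nu> *\<^sub>C (dotted M $ \<nu> $ \<delta> * dotted M $ \<gamma> $ \<eta>))))"
    unfolding sum_distrib_right unfolding sum_distrib_left unfolding sum_distrib_right
    unfolding scaleC_sum_right
    by (rule HOL.trans[OF swap'])
      (simp only: scaleC_scaleC mult_scaleC_left mult_scaleC_right mult_ac mult.assoc)
  also have "\<dots> = spinor_form \<epsilon> a s p' q' *\<^sub>C 1"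
    unfolding U E p' q' spinor_form_Rmat
    by (simp only: scaleC_sum_left sum_distrib_left mult_scaleC_left mult_scaleC_right scaleC_sum_right
        scaleC_scaleC mult_1_left mult_ac)
  finally show ?thesis .
qed

end

section \<open>The quantum Lorentz group\<close>

lemma scaleC_contract:
  "(\<Sum>i\<in>I. c i *\<^sub>C (\<Sum>j\<in>J. d i j *\<^sub>C x j)) = (\<Sum>j\<in>J. (\<Sum>i\<in>I. c i * d i j) *\<^sub>C x j)"
  unfolding scaleC_sum_left scaleC_sum_right scaleC_scaleC by (rule sum.swap)

locale quantum_lorentz = quantum_SL2C \<epsilon> a \<Delta> counit S M + quantum_pauli \<sigma>
  for \<epsilon> :: "complex^2^2" and a :: real
    and \<Delta> :: "'a::complex_star_algebra_1 \<Rightarrow> ('a, 'a) tensor"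
    and counit :: "'a \<Rightarrow> complex" and S :: "'a \<Rightarrow> 'a" and M :: "'a^2^2"
    and \<sigma> :: "4 \<Rightarrow> complex^2^2"
begin

sublocale spinor_pauli \<epsilon> a \<sigma> ..

abbreviation \<Lambda> :: "pm \<Rightarrow> 4 \<Rightarrow> 4 \<Rightarrow> 'a" where
  "\<Lambda> \<equiv> lorentz_gen \<epsilon> a \<sigma> M"

lemma lorentz_gen_eq:
  "\<Lambda> s L K = (\<^bold>\<Sum>p. pauli_dual s L p *\<^sub>C (\<^bold>\<Sum>q. entry (\<sigma> K) q *\<^sub>C vector_rep p q))"
proof -
  have swap: "(\<^bold>\<Sum>\<gamma> \<delta> \<alpha> \<tau> \<rho> \<beta>. F \<alpha> \<beta> \<delta> \<gamma> \<tau> \<rho>) = (\<^bold>\<Sum>\<alpha> \<beta> \<delta> \<gamma> \<tau> \<rho>. F \<alpha> \<beta> \<delta> \<gamma> \<tau> \<rho>)"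
    for F :: "2 \<Rightarrow> 2 \<Rightarrow> 2 \<Rightarrow> 2 \<Rightarrow> 2 \<Rightarrow> 2 \<Rightarrow> 'a"
    unfolding sum.cartesian_product UNIV_Times_UNIV
    by (rule sum.reindex_bij_witness[of _ "\<lambda>(\<alpha>, \<beta>, \<delta>, \<gamma>, \<tau>, \<rho>). (\<gamma>, \<delta>, \<alpha>, \<tau>, \<rho>, \<beta>)" "\<lambda>(\<gamma>, \<delta>, \<alpha>, \<tau>, \<rho>, \<beta>). (\<alpha>, \<beta>, \<delta>, \<gamma>, \<tau>, \<rho>)"]) auto
  show ?thesis
    unfolding lorentz_gen_def pauli_dual_def twist_def sum_pair fst_conv snd_conv eps_dot_eq eps_dot_up_eq
      scaleC_sum_left sum_distrib_left sum_distrib_right vector_rep_def scaleC_sum_right[of "1 / Qc a"]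
    by (rule HOL.trans[OF swap])
      (simp only: scaleC_sum_right scaleC_scaleC mult_minus_left mult_minus_right minus_minus mult_ac)
qed

text \<open>The sign \<open>s\<close> occurs on the left only: the expansion determines the generators, so they do not
  depend on it.\<close>

lemma lorentz_gen_expansion:
  "(\<^bold>\<Sum>L. entry (\<sigma> L) p *\<^sub>C \<Lambda> s L K) = (\<^bold>\<Sum>q. entry (\<sigma> K) q *\<^sub>C vector_rep p q)"
proof -
  let ?X = "\<lambda>p. \<^bold>\<Sum>q. entry (\<sigma> K) q *\<^sub>C vector_rep p q"
  have "(\<^bold>\<Sum>L. entry (\<sigma> L) p *\<^sub>C \<Lambda> s L K) = (\<^bold>\<Sum>r. (\<^bold>\<Sum>L. entry (\<sigma> L) p * pauli_dual s L r) *\<^sub>C ?X r)"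
    unfolding lorentz_gen_eq by (rule scaleC_contract)
  then show ?thesis by (simp only: pauli_pauli_dual sum_of_bool_scaleC)
qed

lemma pauli_expansion_unique:
  assumes "\<And>p. (\<^bold>\<Sum>L. entry (\<sigma> L) p *\<^sub>C x L) = (\<^bold>\<Sum>L. entry (\<sigma> L) p *\<^sub>C (y L :: 'a))"
  shows "x L = y L"
proof -
  have "z L = (\<^bold>\<Sum>p. pauli_dual Plus L p *\<^sub>C (\<^bold>\<Sum>K. entry (\<sigma> K) p *\<^sub>C z K))" for z :: "4 \<Rightarrow> 'a"
  proof -
    have "(\<^bold>\<Sum>p. pauli_dual Plus L p *\<^sub>C (\<^bold>\<Sum>K. entry (\<sigma> K) p *\<^sub>C z K))
      = (\<^bold>\<Sum>K. (\<^bold>\<Sum>p. pauli_dual Plus L p * entry (\<sigma> K) p) *\<^sub>C z K)"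
      by (rule scaleC_contract)
    then show ?thesis by (simp only: pauli_dual_pauli sum_of_bool_scaleC)
  qed
  from this[of x] this[of y] assms show ?thesis by simp
qed

text \<open>\<open>M \<sigma>\<^sup>K M\<^sup>*\<close> is hermitean, and the hermitean \<open>\<sigma>\<close> form a basis.\<close>

lemma star_lorentz_gen: "star (\<Lambda> s L K) = \<Lambda> s L K"
proof (rule pauli_expansion_unique[of "\<lambda>L. star (\<Lambda> s L K)"])
  fix p :: "2 \<times> 2"
  let ?p = "(snd p, fst p)"
  have "(\<^bold>\<Sum>L. entry (\<sigma> L) p *\<^sub>C star (\<Lambda> s L K)) = star (\<^bold>\<Sum>L. entry (\<sigma> L) ?p *\<^sub>C \<Lambda> s L K)"
    by (simp add: star_sum star_scaleC hermitean)
  also have "\<dots> = (\<^bold>\<Sum>\<tau> \<rho>. \<sigma> K $ \<rho> $ \<tau> *\<^sub>C vector_rep p (\<rho>, \<tau>))"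
    unfolding lorentz_gen_expansion
    by (simp add: star_sum star_scaleC hermitean sum_pair vector_rep_def star_mult star_dotted star_M)
  also have "\<dots> = (\<^bold>\<Sum>L. entry (\<sigma> L) p *\<^sub>C \<Lambda> s L K)"
    unfolding lorentz_gen_expansion by (subst sum.swap) (simp add: sum_pair)
  finally show "(\<^bold>\<Sum>L. entry (\<sigma> L) p *\<^sub>C star (\<Lambda> s L K)) = (\<^bold>\<Sum>L. entry (\<sigma> L) p *\<^sub>C \<Lambda> s L K)" .
qed

text \<open>The left-hand side is \<open>b(M \<sigma>\<^sup>N M\<^sup>*, M \<sigma>\<^sup>P M\<^sup>*)\<close>, expanded in Pauli matrices.\<close>

lemma metric_up_invariant:
  "(\<^bold>\<Sum>L K. metric_up \<epsilon> a \<sigma> t $ L $ K *\<^sub>C (\<Lambda> s L N * \<Lambda> s K P)) = metric_up \<epsilon> a \<sigma> t $ N $ P *\<^sub>C 1"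
proof -
  let ?f = "spinor_form \<epsilon> a t" and ?V = vector_rep
  have "(\<^bold>\<Sum>L K. metric_up \<epsilon> a \<sigma> t $ L $ K *\<^sub>C (\<Lambda> s L N * \<Lambda> s K P))
    = (\<^bold>\<Sum>L K p q. (entry (\<sigma> L) p * (?f p q * entry (\<sigma> K) q)) *\<^sub>C (\<Lambda> s L N * \<Lambda> s K P))"
    by (simp only: metric_up_eq_right scaleC_sum_left sum_distrib_left)
  also have "\<dots> = (\<^bold>\<Sum>p q L K. (entry (\<sigma> L) p * (?f p q * entry (\<sigma> K) q)) *\<^sub>C (\<Lambda> s L N * \<Lambda> s K P))"
    unfolding sum.cartesian_product UNIV_Times_UNIV
    by (rule sum.reindex_bij_witness[of _ "\<lambda>(p, q, L, K). (L, K, p, q)" "\<lambda>(L, K, p, q). (p, q, L, K)"]) auto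
  also have "\<dots> = (\<^bold>\<Sum>p q. ?f p q *\<^sub>C ((\<^bold>\<Sum>L. entry (\<sigma> L) p *\<^sub>C \<Lambda> s L N) * (\<^bold>\<Sum>K. entry (\<sigma> K) q *\<^sub>C \<Lambda> s K P)))"
    by (simp only: scaleC_sum_right sum_product mult_scaleC_left mult_scaleC_right scaleC_scaleC mult_ac)
  also have "\<dots> = (\<^bold>\<Sum>p q p' q'. (entry (\<sigma> N) p' * (?f p q * entry (\<sigma> P) q')) *\<^sub>C (?V p p' * ?V q q'))"
    unfolding lorentz_gen_expansion
    by (simp only: scaleC_sum_right sum_product mult_scaleC_left mult_scaleC_right scaleC_scaleC mult_ac)
  also have "\<dots> = (\<^bold>\<Sum>p' q' p q. (entry (\<sigma> N) p' * (?f p q * entry (\<sigma> P) q')) *\<^sub>C (?V p p' * ?V q q'))"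
    unfolding sum.cartesian_product UNIV_Times_UNIV
    by (rule sum.reindex_bij_witness[of _ "\<lambda>(p, q, p', q'). (p', q', p, q)" "\<lambda>(p, q, p', q'). (p', q', p, q)"]) auto
  also have "\<dots> = (\<^bold>\<Sum>p' q'. (entry (\<sigma> N) p' * entry (\<sigma> P) q') *\<^sub>C (\<^bold>\<Sum>p q. ?f p q *\<^sub>C (?V p p' * ?V q q')))"
    by (simp only: scaleC_sum_right scaleC_scaleC mult_ac)
  also have "\<dots> = metric_up \<epsilon> a \<sigma> t $ N $ P *\<^sub>C 1"
    unfolding vector_rep_invariant metric_up_eq_right
    by (simp only: scaleC_sum_left sum_distrib_left scaleC_scaleC mult_ac)
  finally show ?thesis .
qed

lemma corep_lorentz_gen: "corep UNIV (\<Lambda> s)"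
proof -
  have "\<Delta> (\<Lambda> s L K) = (\<^bold>\<Sum>N. \<Lambda> s L N \<otimes> \<Lambda> s N K)" for L K
  proof -
    have V: "\<Delta> (vector_rep p q) = (\<^bold>\<Sum>r. vector_rep p r \<otimes> vector_rep r q)" for p q
      using corep_vector_rep unfolding corep_def by blast
    have "\<Delta> (\<Lambda> s L K) = (\<^bold>\<Sum>p q r. (pauli_dual s L p * entry (\<sigma> K) q) *\<^sub>C (vector_rep p r \<otimes> vector_rep r q))"
      by (simp add: lorentz_gen_eq comult_sum comult_scaleC V scaleC_sum_right scaleC_scaleC)
    also have "\<dots> = (\<^bold>\<Sum>p r q. (pauli_dual s L p * entry (\<sigma> K) q) *\<^sub>C (vector_rep p r \<otimes> vector_rep r q))"
      by (rule sum.cong[OF HOL.refl sum.swap])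
    also have "\<dots> = (\<^bold>\<Sum>p r. pauli_dual s L p *\<^sub>C (vector_rep p r \<otimes> (\<^bold>\<Sum>q. entry (\<sigma> K) q *\<^sub>C vector_rep r q)))"
      by (simp add: scaleC_sum_right scaleC_scaleC tens_sum_right tens_scaleC_right)
    also have "\<dots> = (\<^bold>\<Sum>p r N. (pauli_dual s L p * entry (\<sigma> N) r) *\<^sub>C (vector_rep p r \<otimes> \<Lambda> s N K))"
      unfolding lorentz_gen_expansion[of _ s, symmetric]
      by (simp add: scaleC_sum_right scaleC_scaleC tens_sum_right tens_scaleC_right)
    also have "\<dots> = (\<^bold>\<Sum>N p r. (pauli_dual s L p * entry (\<sigma> N) r) *\<^sub>C (vector_rep p r \<otimes> \<Lambda> s N K))"
      unfolding sum.cartesian_product UNIV_Times_UNIV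
      by (rule sum.reindex_bij_witness[of _ "\<lambda>(N, p, r). (p, r, N)" "\<lambda>(p, r, N). (N, p, r)"]) auto
    also have "\<dots> = (\<^bold>\<Sum>N. \<Lambda> s L N \<otimes> \<Lambda> s N K)"
      by (simp add: lorentz_gen_eq[of s L] scaleC_sum_right scaleC_scaleC tens_sum_left tens_scaleC_left)
    finally show ?thesis .
  qed
  moreover have "counit (\<Lambda> s L K) = of_bool (L = K)" for L K
  proof -
    have "counit (vector_rep p q) = of_bool (p = q)" for p q
      using corep_vector_rep unfolding corep_def by blast
    then have "counit (\<Lambda> s L K) = (\<^bold>\<Sum>p. pauli_dual s L p * entry (\<sigma> K) p)"
      by (simp add: lorentz_gen_eq counit_sum counit_scaleC sum_of_bool)
    then show ?thesis by (simp add: pauli_dual_pauli)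
  qed
  ultimately show ?thesis by (simp add: corep_def)
qed

text \<open>Multiplying the invariance of the upper metric by the lower one exhibits a left inverse of the
  matrix of generators, which can only be its antipode.\<close>

lemma antipode_lorentz_gen:
  "S (\<Lambda> s Q K) = (\<^bold>\<Sum>L N. (metric_low \<epsilon> a \<sigma> t $ Q $ N * metric_up \<epsilon> a \<sigma> t $ L $ K) *\<^sub>C \<Lambda> s L N)"
proof (rule antipode_eq_left_inverse[OF corep_lorentz_gen, of _ _ "\<lambda>Q K. \<^bold>\<Sum>L N. (metric_low \<epsilon> a \<sigma> t $ Q $ N * metric_up \<epsilon> a \<sigma> t $ L $ K) *\<^sub>C \<Lambda> s L N"])
  fix P
  let ?g = "metric_low \<epsilon> a \<sigma> t" and ?G = "metric_up \<epsilon> a \<sigma> t"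
  have "(\<^bold>\<Sum>K. (\<^bold>\<Sum>L N. (?g $ Q $ N * ?G $ L $ K) *\<^sub>C \<Lambda> s L N) * \<Lambda> s K P)
     = (\<^bold>\<Sum>K L N. (?g $ Q $ N * ?G $ L $ K) *\<^sub>C (\<Lambda> s L N * \<Lambda> s K P))"
    by (simp add: sum_distrib_right mult_scaleC_left)
  also have "\<dots> = (\<^bold>\<Sum>N L K. (?g $ Q $ N * ?G $ L $ K) *\<^sub>C (\<Lambda> s L N * \<Lambda> s K P))"
    unfolding sum.cartesian_product UNIV_Times_UNIV
    by (rule sum.reindex_bij_witness[of _ "\<lambda>(N, L, K). (K, L, N)" "\<lambda>(K, L, N). (N, L, K)"]) auto
  also have "\<dots> = (\<^bold>\<Sum>N. ?g $ Q $ N *\<^sub>C (\<^bold>\<Sum>L K. ?G $ L $ K *\<^sub>C (\<Lambda> s L N * \<Lambda> s K P)))"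
    by (simp add: scaleC_sum_right scaleC_scaleC)
  also have "\<dots> = (\<^bold>\<Sum>N. ?g $ Q $ N * ?G $ N $ P) *\<^sub>C 1"
    unfolding metric_up_invariant by (simp add: scaleC_sum_left scaleC_scaleC)
  finally show "(\<^bold>\<Sum>K. (\<^bold>\<Sum>L N. (?g $ Q $ N * ?G $ L $ K) *\<^sub>C \<Lambda> s L N) * \<Lambda> s K P) = of_bool (Q = P)"
    by (simp add: metric_inverse scaleC_one)
qed simp_all

text \<open>The invariance of the upper metric says that the antipode is a left inverse; this is the fact
  that it is also a right inverse, freed from the upper metric.\<close>

lemma metric_low_invariant:
  "(\<^bold>\<Sum>N P. metric_low \<epsilon> a \<sigma> t $ N $ P *\<^sub>C (\<Lambda> s L N * \<Lambda> s K P)) = metric_low \<epsilon> a \<sigma> t $ L $ K *\<^sub>C 1"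
proof -
  let ?g = "metric_low \<epsilon> a \<sigma> t" and ?G = "metric_up \<epsilon> a \<sigma> t"
  let ?m = "\<lambda>J. \<^bold>\<Sum>N P. ?g $ N $ P *\<^sub>C (\<Lambda> s L N * \<Lambda> s J P)"
  have 1: "(\<^bold>\<Sum>J. ?G $ J $ I *\<^sub>C ?m J) = of_bool (L = I)" for I
  proof -
    have "of_bool (L = I) = (\<^bold>\<Sum>N. \<Lambda> s L N * S (\<Lambda> s N I))"
      using corep_antipode(2)[OF corep_lorentz_gen, of L I] by simp
    also have "\<dots> = (\<^bold>\<Sum>N J P. (?G $ J $ I * ?g $ N $ P) *\<^sub>C (\<Lambda> s L N * \<Lambda> s J P))"
      unfolding antipode_lorentz_gen[of s _ _ t] by (simp add: sum_distrib_left mult_scaleC_right mult.commute)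
    also have "\<dots> = (\<^bold>\<Sum>J N P. (?G $ J $ I * ?g $ N $ P) *\<^sub>C (\<Lambda> s L N * \<Lambda> s J P))"
      by (rule sum.swap)
    finally show ?thesis by (simp add: scaleC_sum_right scaleC_scaleC)
  qed
  have "?m K = (\<^bold>\<Sum>J. (\<^bold>\<Sum>I. ?G $ J $ I * ?g $ I $ K) *\<^sub>C ?m J)"
    by (simp add: metric_inverse sum_of_bool_scaleC)
  also have "\<dots> = (\<^bold>\<Sum>I. ?g $ I $ K *\<^sub>C (\<^bold>\<Sum>J. ?G $ J $ I *\<^sub>C ?m J))"
    unfolding mult.commute[of "?G $ _ $ _"] by (rule scaleC_contract[THEN HOL.sym])
  also have "\<dots> = (\<^bold>\<Sum>I. of_bool (L = I) *\<^sub>C (?g $ I $ K *\<^sub>C 1))"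
    unfolding 1 by (rule sum.cong) (simp_all add: scaleC_one of_bool_def)
  finally show ?thesis by (simp only: sum_of_bool_scaleC)
qed

lemma hopf_algebra_lorentz: "hopf_algebra (lorentz_algebra \<epsilon> a \<sigma> M s) \<Delta> counit S"
proof (rule hopf_subalgebra[OF corep_lorentz_gen[of s]])
  show L: "lorentz_algebra \<epsilon> a \<sigma> M s = unital_subalgebra hull {\<Lambda> s i j |i j. i \<in> UNIV \<and> j \<in> UNIV}"
    by (simp add: lorentz_algebra_def)
  have sub: "complex_vector.subspace (lorentz_algebra \<epsilon> a \<sigma> M s)"
    unfolding L by (intro unital_subalgebra_subspace unital_subalgebra_hull)
  have gens: "\<Lambda> s L K \<in> lorentz_algebra \<epsilon> a \<sigma> M s" for L K
    unfolding L by (rule hull_inc) auto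
  show "S (\<Lambda> s L K) \<in> lorentz_algebra \<epsilon> a \<sigma> M s" for L K
    unfolding antipode_lorentz_gen[of s L K s]
    by (intro complex_vector.subspace_sum[OF sub] complex_vector.subspace_scale[OF sub] gens)
qed (simp_all add: S_mult)

lemma lorentz_gen_inv_antipode:
  "\<Lambda> s L K = (1 / Qc a) *\<^sub>C (\<^bold>\<Sum>\<gamma> \<alpha> \<tau> \<rho>.
     (pauli_bar_mixed \<epsilon> a \<sigma> s L \<gamma> \<alpha> * pauli_mixed \<epsilon> \<sigma> K \<tau> \<rho>)
       *\<^sub>C (M $ \<alpha> $ \<tau> * inv S (dotted M $ \<rho> $ \<gamma>)))"
proof -
  have lower: "(\<^bold>\<Sum>\<rho>. pauli_mixed \<epsilon> \<sigma> K \<tau> \<rho> * eps_up \<epsilon> $ \<rho> $ \<kappa>) = - \<sigma> K $ \<tau> $ \<kappa>" for \<tau> \<kappa>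
  proof -
    have "(\<^bold>\<Sum>\<rho>. pauli_mixed \<epsilon> \<sigma> K \<tau> \<rho> * eps_up \<epsilon> $ \<rho> $ \<kappa>)
        = - (\<^bold>\<Sum>\<beta>. \<sigma> K $ \<tau> $ \<beta> * (\<^bold>\<Sum>\<rho>. \<epsilon> $ \<beta> $ \<rho> * eps_up \<epsilon> $ \<rho> $ \<kappa>))"
      by (simp add: pauli_mixed_def eps_dot_up_eq sum_2 algebra_simps)
    then show ?thesis by (simp add: eps_eps_up sum_of_bool)
  qed
  have "(\<^bold>\<Sum>\<gamma> \<alpha> \<tau> \<rho>. (pauli_bar_mixed \<epsilon> a \<sigma> s L \<gamma> \<alpha> * pauli_mixed \<epsilon> \<sigma> K \<tau> \<rho>)
       *\<^sub>C (M $ \<alpha> $ \<tau> * inv S (dotted M $ \<rho> $ \<gamma>)))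
    = (\<^bold>\<Sum>\<gamma> \<alpha> \<tau> \<rho> \<delta> \<kappa>. (pauli_bar_mixed \<epsilon> a \<sigma> s L \<gamma> \<alpha> * \<epsilon> $ \<delta> $ \<gamma>
         * (pauli_mixed \<epsilon> \<sigma> K \<tau> \<rho> * eps_up \<epsilon> $ \<rho> $ \<kappa>)) *\<^sub>C (M $ \<alpha> $ \<tau> * dotted M $ \<delta> $ \<kappa>))"
    unfolding inv_S_dotted_M
    by (simp add: sum_distrib_left mult_scaleC_right scaleC_sum_right scaleC_scaleC mult_ac)
  also have "\<dots> = (\<^bold>\<Sum>\<gamma> \<alpha> \<tau> \<delta> \<kappa> \<rho>. (pauli_bar_mixed \<epsilon> a \<sigma> s L \<gamma> \<alpha> * \<epsilon> $ \<delta> $ \<gamma>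
         * (pauli_mixed \<epsilon> \<sigma> K \<tau> \<rho> * eps_up \<epsilon> $ \<rho> $ \<kappa>)) *\<^sub>C (M $ \<alpha> $ \<tau> * dotted M $ \<delta> $ \<kappa>))"
    unfolding sum.cartesian_product UNIV_Times_UNIV
    by (rule sum.reindex_bij_witness[of _ "\<lambda>(\<gamma>, \<alpha>, \<tau>, \<delta>, \<kappa>, \<rho>). (\<gamma>, \<alpha>, \<tau>, \<rho>, \<delta>, \<kappa>)" "\<lambda>(\<gamma>, \<alpha>, \<tau>, \<rho>, \<delta>, \<kappa>). (\<gamma>, \<alpha>, \<tau>, \<delta>, \<kappa>, \<rho>)"]) auto
  also have "\<dots> = (\<^bold>\<Sum>\<gamma> \<alpha> \<tau> \<delta> \<kappa>. (pauli_bar_mixed \<epsilon> a \<sigma> s L \<gamma> \<alpha> * \<epsilon> $ \<delta> $ \<gamma> * - \<sigma> K $ \<tau> $ \<kappa>)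
         *\<^sub>C (M $ \<alpha> $ \<tau> * dotted M $ \<delta> $ \<kappa>))"
    unfolding scaleC_sum_left[symmetric] sum_distrib_left[symmetric] lower ..
  also have "\<dots> = (\<^bold>\<Sum>\<gamma> \<alpha> \<tau> \<beta> \<rho> \<delta>. (eps_dot \<epsilon> $ \<gamma> $ \<delta> * pauli_bar_low \<epsilon> a \<sigma> s L \<delta> \<alpha> * \<sigma> K $ \<tau> $ \<rho> * eps_dot_up \<epsilon> $ \<gamma> $ \<beta>)
       *\<^sub>C (M $ \<alpha> $ \<tau> * dotted M $ \<beta> $ \<rho>))"
    by (simp add: pauli_bar_mixed_def eps_dot_up_eq scaleC_sum_left sum_distrib_left sum_distrib_right mult_ac)
  also have "\<dots> = (\<^bold>\<Sum>\<gamma> \<delta> \<alpha> \<tau> \<rho> \<beta>. (eps_dot \<epsilon> $ \<gamma> $ \<delta> * pauli_bar_low \<epsilon> a \<sigma> s L \<delta> \<alpha> * \<sigma> K $ \<tau> $ \<rho> * eps_dot_up \<epsilon> $ \<gamma> $ \<beta>)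
       *\<^sub>C (M $ \<alpha> $ \<tau> * dotted M $ \<beta> $ \<rho>))"
    unfolding sum.cartesian_product UNIV_Times_UNIV
    by (rule sum.reindex_bij_witness[of _ "\<lambda>(\<gamma>, \<delta>, \<alpha>, \<tau>, \<rho>, \<beta>). (\<gamma>, \<alpha>, \<tau>, \<beta>, \<rho>, \<delta>)" "\<lambda>(\<gamma>, \<alpha>, \<tau>, \<beta>, \<rho>, \<delta>). (\<gamma>, \<delta>, \<alpha>, \<tau>, \<rho>, \<beta>)"]) auto
  finally show ?thesis by (simp only: lorentz_gen_def)
qed

text \<open>Contracting the form with a Pauli matrix on the right, and with the lower metric, is another
  way to extract the coefficient of \<open>\<sigma> L\<close>.\<close>

lemma lorentz_gen_metric_low:
  "\<Lambda> s L K = (1 / Qc a) *\<^sub>C (\<^bold>\<Sum>\<alpha> \<delta> \<tau> \<rho> \<beta> N \<gamma>.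
     (eps_up \<epsilon> $ \<alpha> $ \<delta> * \<sigma> K $ \<tau> $ \<rho> * pauli_bar \<epsilon> a \<sigma> t N \<beta> \<gamma> * \<epsilon> $ \<gamma> $ \<delta>
        * metric_low \<epsilon> a \<sigma> t $ N $ L) *\<^sub>C (M $ \<alpha> $ \<tau> * dotted M $ \<beta> $ \<rho>))"
proof -
  let ?g = "metric_low \<epsilon> a \<sigma> t" and ?f = "spinor_form \<epsilon> a t"
  let ?X = "\<lambda>p. \<^bold>\<Sum>q. entry (\<sigma> K) q *\<^sub>C vector_rep p q"
  have swap: "(\<^bold>\<Sum>\<alpha> \<delta> \<tau> \<rho> \<beta> N \<gamma>. F \<alpha> \<beta> N \<gamma> \<delta> \<tau> \<rho>) = (\<^bold>\<Sum>\<alpha> \<beta> N \<gamma> \<delta> \<tau> \<rho>. F \<alpha> \<beta> N \<gamma> \<delta> \<tau> \<rho>)"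
    for F :: "2 \<Rightarrow> 2 \<Rightarrow> 4 \<Rightarrow> 2 \<Rightarrow> 2 \<Rightarrow> 2 \<Rightarrow> 2 \<Rightarrow> 'a"
    unfolding sum.cartesian_product UNIV_Times_UNIV
    by (rule sum.reindex_bij_witness[of _ "\<lambda>(\<alpha>, \<beta>, N, \<gamma>, \<delta>, \<tau>, \<rho>). (\<alpha>, \<delta>, \<tau>, \<rho>, \<beta>, N, \<gamma>)" "\<lambda>(\<alpha>, \<delta>, \<tau>, \<rho>, \<beta>, N, \<gamma>). (\<alpha>, \<beta>, N, \<gamma>, \<delta>, \<tau>, \<rho>)"]) auto
  have "(1 / Qc a) *\<^sub>C (\<^bold>\<Sum>\<alpha> \<delta> \<tau> \<rho> \<beta> N \<gamma>.
     (eps_up \<epsilon> $ \<alpha> $ \<delta> * \<sigma> K $ \<tau> $ \<rho> * pauli_bar \<epsilon> a \<sigma> t N \<beta> \<gamma> * \<epsilon> $ \<gamma> $ \<delta>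
        * ?g $ N $ L) *\<^sub>C (M $ \<alpha> $ \<tau> * dotted M $ \<beta> $ \<rho>))
    = (\<^bold>\<Sum>p. (\<^bold>\<Sum>N. (\<^bold>\<Sum>q. ?f p q * entry (\<sigma> N) q) * ?g $ N $ L) *\<^sub>C ?X p)"
    unfolding spinor_form_pauli_right twist_def sum_pair fst_conv snd_conv scaleC_sum_left
      sum_distrib_left sum_distrib_right vector_rep_def scaleC_sum_right[of "1 / Qc a"]
    by (rule HOL.trans[OF swap])
      (simp only: scaleC_sum_right scaleC_scaleC mult_minus_left mult_minus_right minus_minus mult_ac)
  also have "\<dots> = (\<^bold>\<Sum>p N P. (entry (\<sigma> P) p * (\<^bold>\<Sum>q. ?f p q * entry (\<sigma> N) q) * ?g $ N $ L) *\<^sub>C \<Lambda> s P K)"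
    unfolding lorentz_gen_expansion[of _ s, symmetric] scaleC_sum_left
    by (simp add: scaleC_sum_right scaleC_scaleC mult_ac)
  also have "\<dots> = (\<^bold>\<Sum>P N p. (entry (\<sigma> P) p * (\<^bold>\<Sum>q. ?f p q * entry (\<sigma> N) q) * ?g $ N $ L) *\<^sub>C \<Lambda> s P K)"
    unfolding sum.cartesian_product UNIV_Times_UNIV
    by (rule sum.reindex_bij_witness[of _ "\<lambda>(P, N, p). (p, N, P)" "\<lambda>(p, N, P). (P, N, p)"]) auto
  also have "\<dots> = (\<^bold>\<Sum>P. (\<^bold>\<Sum>N. metric_up \<epsilon> a \<sigma> t $ P $ N * ?g $ N $ L) *\<^sub>C \<Lambda> s P K)"
    unfolding metric_up_eq_right sum_distrib_right[of _ _ "?g $ _ $ L"] scaleC_sum_left ..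
  also have "\<dots> = \<Lambda> s L K"
    by (simp add: metric_inverse sum_of_bool_scaleC)
  finally show ?thesis by (rule HOL.sym)
qed

end

theorem mainTheorem3:
  fixes \<epsilon> :: "complex^2^2" and a :: real
    and \<Delta> :: "'a::complex_star_algebra_1 \<Rightarrow> ('a, 'a) tensor"
    and counit :: "'a \<Rightarrow> complex" and S :: "'a \<Rightarrow> 'a" and M :: "'a^2^2"
    and \<sigma> :: "4 \<Rightarrow> complex^2^2"
  assumes "quantum_SL2C \<epsilon> a \<Delta> counit S M"
    and "quantum_pauli \<sigma>"
  shows "\<forall>s. let \<Lambda> = lorentz_gen \<epsilon> a \<sigma> M s; \<L> = lorentz_algebra \<epsilon> a \<sigma> M s in
      (\<forall>L K. \<Lambda> L K = (1 / Qc a) *\<^sub>C (\<^bold>\<Sum>\<gamma> \<alpha> \<tau> \<rho>.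
          (pauli_bar_mixed \<epsilon> a \<sigma> s L \<gamma> \<alpha> * pauli_mixed \<epsilon> \<sigma> K \<tau> \<rho>)
            *\<^sub>C (M $ \<alpha> $ \<tau> * inv S (dotted M $ \<rho> $ \<gamma>))))
    \<and> (\<forall>t L K. \<Lambda> L K = (1 / Qc a) *\<^sub>C (\<^bold>\<Sum>\<alpha> \<delta> \<tau> \<rho> \<beta> N \<gamma>.
          (eps_up \<epsilon> $ \<alpha> $ \<delta> * \<sigma> K $ \<tau> $ \<rho> * pauli_bar \<epsilon> a \<sigma> t N \<beta> \<gamma> * \<epsilon> $ \<gamma> $ \<delta>
             * metric_low \<epsilon> a \<sigma> t $ N $ L)
            *\<^sub>C (M $ \<alpha> $ \<tau> * dotted M $ \<beta> $ \<rho>)))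
    \<and> (\<forall>L K. star (\<Lambda> L K) = \<Lambda> L K)
    \<and> hopf_algebra \<L> \<Delta> counit S
    \<and> (\<forall>t L K. (\<^bold>\<Sum>N P. metric_low \<epsilon> a \<sigma> t $ N $ P *\<^sub>C (\<Lambda> L N * \<Lambda> K P)) = metric_low \<epsilon> a \<sigma> t $ L $ K *\<^sub>C 1)
    \<and> (\<forall>t N P. (\<^bold>\<Sum>L K. metric_up \<epsilon> a \<sigma> t $ L $ K *\<^sub>C (\<Lambda> L N * \<Lambda> K P)) = metric_up \<epsilon> a \<sigma> t $ N $ P *\<^sub>C 1)"
proof -
  interpret quantum_lorentz \<epsilon> a \<Delta> counit S M \<sigma>
    using assms by (rule quantum_lorentz.intro)
  show ?thesis
    unfolding Let_def
    by (intro allI conjI lorentz_gen_inv_antipode lorentz_gen_metric_low star_lorentz_gen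
        hopf_algebra_lorentz metric_low_invariant metric_up_invariant)
qed

end
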